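(* Let $R=\begin{pmatrix}2&1\\0&2\end{pmatrix}$, $B=\left\{\begin{pmatrix}0\\0\end{pmatrix},\begin{pmatrix}1\\0\end{pmatrix}\right\}$, and let $\mu_{R,B}$ be the self-affine measure on $\mathbb{R}^2$ generated by $R$ and $B$. Then for every $(t,s)\in(0,1)\times[0,\infty)$ there exists a spectrum $\Lambda_{t,s}$ of $\mu_{R,B}$ such that $$\dim_{Be}(\Lambda_{t,s})=t\quad\text{and}\quad D_t^+(\Lambda_{t,s})=s.$$
   Context: Self-affine measure: $\mu_{R,B}$ is the unique Borel probability measure on $\mathbb{R}^2$ satisfying $\mu(E)=\sum_{b\in B}\frac{1}{\#B}\,\mu(\varphi_b^{-1}(E))$ for all Borel sets $E\subseteq\mathbb{R}^2$, where $\varphi_b(x)=R^{-1}(x+b)$. Spectrum: a discrete set $\Lambda\subseteq\mathbb{R}^2$ is a spectrum of a Borel probability measure $\mu$ on $\mathbb{R}^2$ if $E(\Lambda)=\{e^{-2\pi i\langle\lambda,x\rangle}:\lambda\in\Lambda\}$ is an orthonormal basis of $L^2(\mu)$. Beurling density and dimension: for a discrete set $\Lambda\subseteq\mathbb{R}^2$ and $r>0$, the upper $r$-Beurling density is $D_r^+(\Lambda)=\limsup_{h\to\infty}\sup_{x\in\mathbb{R}^2}\frac{\#(\Lambda\cap B(x,h))}{h^r}$, where $B(x,h)$ is the open Euclidean ball with center $x$ and radius $h$. The Beurling dimension is $\dim_{Be}(\Lambda)=\inf\{r>0: D_r^+(\Lambda)=0\}=\sup\{r>0: D_r^+(\Lambda)=\infty\}$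 (with the supremum of the empty set taken to be $0$). *)

theory Defs
  imports "HOL-Probability.Probability_Measure"
begin

definition affine_contraction :: "real^2^2 \<Rightarrow> real^2 \<Rightarrow> real^2 \<Rightarrow> real^2" where
  "affine_contraction R b x = matrix_inv R *v (x + b)"

text \<open>
  The definite description denotes the self-affine measure only when existence and uniqueness
  hold for the given \<open>R\<close> and \<open>B\<close>, e.g. for an expanding \<open>R\<close> and a finite nonempty \<open>B\<close>.
\<close>

definition self_affine_measure :: "real^2^2 \<Rightarrow> (real^2) set \<Rightarrow> (real^2) measure" where
  "self_affine_measure R B =
     (THE \<mu>. sets \<mu> = sets borel \<and> prob_space \<mu> \<and>
        (\<forall>E\<in>sets borel.
           measure \<mu> E =
             (\<Sum>b\<in>B. 1 / real (card B) * measure \<mu> (affine_contraction R b -` E))))"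

definition square_integrable :: "'a measure \<Rightarrow> ('a \<Rightarrow> complex) \<Rightarrow> bool" where
  "square_integrable M f \<longleftrightarrow>
     f \<in> borel_measurable M \<and> integrable M (\<lambda>x. (cmod (f x))\<^sup>2)"

definition L2_norm :: "'a measure \<Rightarrow> ('a \<Rightarrow> complex) \<Rightarrow> real" where
  "L2_norm M f = sqrt (LINT x|M. (cmod (f x))\<^sup>2)"

definition L2_inner :: "'a measure \<Rightarrow> ('a \<Rightarrow> complex) \<Rightarrow> ('a \<Rightarrow> complex) \<Rightarrow> complex" where
  "L2_inner M f g = (LINT x|M. f x * cnj (g x))"

text \<open>
  An orthonormal family whose linear span is dense in \<open>L\<^sup>2(M)\<close>, stated on square-integrable
  representatives.  As the basis is an indexed family, functions with distinct indices must be
  orthogonal; in particular they cannot agree almost everywhere.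
\<close>

definition orthonormal_basis_L2 :: "'a measure \<Rightarrow> 'i set \<Rightarrow> ('i \<Rightarrow> 'a \<Rightarrow> complex) \<Rightarrow> bool" where
  "orthonormal_basis_L2 M I e \<longleftrightarrow>
     (\<forall>i\<in>I. square_integrable M (e i)) \<and>
     (\<forall>i\<in>I. \<forall>j\<in>I. L2_inner M (e i) (e j) = (if i = j then 1 else 0)) \<and>
     (\<forall>f. square_integrable M f \<longrightarrow>
        (\<forall>\<epsilon>>0. \<exists>F c. finite F \<and> F \<subseteq> I \<and>
           L2_norm M (\<lambda>x. f x - (\<Sum>i\<in>F. c i * e i x)) < \<epsilon>))"

definition is_spectrum :: "(real^2) measure \<Rightarrow> (real^2) set \<Rightarrow> bool" where
  "is_spectrum \<mu> \<Lambda> \<longleftrightarrow>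
     discrete \<Lambda> \<and>
     orthonormal_basis_L2 \<mu> \<Lambda> (\<lambda>l x. exp (- 2 * complex_of_real pi * \<i> * complex_of_real (l \<bullet> x)))"

text \<open>
  Points are counted with the counting measure because a discrete set may accumulate outside
  itself and so meet a ball in infinitely many points, where \<^const>\<open>card\<close> would give \<open>0\<close>.
\<close>

definition upper_beurling_density :: "real \<Rightarrow> (real^2) set \<Rightarrow> ennreal" where
  "upper_beurling_density r \<Lambda> =
     Limsup at_top (\<lambda>h::real.
       SUP x. emeasure (count_space UNIV) (\<Lambda> \<inter> ball x h) / ennreal (h powr r))"

definition beurling_dim :: "(real^2) set \<Rightarrow> ennreal" where
  "beurling_dim \<Lambda> = Inf {ennreal r |r. r > 0 \<and> upper_beurling_density r \<Lambda> = 0}"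

end

theory Submission
  imports Defs "HOL-Probability.Probability" "HOL-Real_Asymp.Real_Asymp"
begin

text \<open>
  Both maps halve the second coordinate and send the horizontal axis to itself, where they act as
  \<open>x \<mapsto> x/2\<close> and \<open>x \<mapsto> (x+1)/2\<close>.  Hence the measure is Lebesgue measure on \<open>[0,1] \<times> {0}\<close>, and the
  graph \<open>{(n, f n) | n \<in> \<int>}\<close> of every function \<open>f : \<int> \<rightarrow> \<real>\<close> is a spectrum, because the second
  coordinate is invisible on the support.  Enumerate the integers as \<open>n\<^sub>0, n\<^sub>1, \<dots>\<close> with
  \<open>|n\<^sub>k| \<le> k\<close> and give \<open>n\<^sub>k\<close> the height \<open>(k w\<^sub>k) powr (1/t)\<close> for a nondecreasing weight \<open>w\<close>.
  Heights are superadditive, so no ball of radius \<open>h\<close> contains more points than there are heights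
  below \<open>2h\<close>; as \<open>t < 1\<close>, the first coordinates are negligible and this bound is asymptotically
  attained.  The density at \<open>t\<close> is therefore \<open>2 powr t / lim w\<close>: a constant weight realises any
  \<open>s > 0\<close>, a logarithmic one realises \<open>s = 0\<close> without lowering the dimension.
\<close>

section \<open>Identification of the self-affine measure\<close>

text \<open>
  Iterating towards one of the ends of the line at which \<open>g\<close> vanishes replaces a fixed fraction
  of the bound \<open>S = sup |g|\<close> by \<open>S / 2\<close>; the end is chosen according to the half-line
  \<open>x \<ge> 1/2\<close> or \<open>x \<le> 1/2\<close>.
\<close>

lemma dyadic_refinement_zero:
  fixes g :: "real \<Rightarrow> real"
  assumes rec: "\<And>x. 2 * g x = g (2 * x) + g (2 * x - 1)"
    and bdd: "bounded (range g)"
    and top: "(g \<longlongrightarrow> 0) at_top" and bot: "(g \<longlongrightarrow> 0) at_bot"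
  shows "g x = 0"
proof -
  define S where "S = (SUP x. \<bar>g x\<bar>)"
  have bdd': "bdd_above (range (\<lambda>x. \<bar>g x\<bar>))"
    using bdd unfolding bounded_iff bdd_above_def by (metis (no_types, lifting) rangeE rangeI real_norm_def)
  have le_S: "\<bar>g x\<bar> \<le> S" for x
    unfolding S_def by (rule cSUP_upper[OF UNIV_I bdd'])
  have S_nonneg: "0 \<le> S"
    using le_S[of 0] by linarith
  \<comment> \<open>Doubling has the fixed point 0 and pushes points to the right of it towards the
    upper end; at each stage the other summand of \<open>rec\<close> is merely bounded by
    \<open>S\<close>.\<close>
  have right: "\<bar>g x\<bar> \<le> (1 - (1/2)^n) * S + (1/2)^n * \<bar>g (2^n * x)\<bar>" for n x
  proof (induction n arbitrary: x)
    case (Suc n)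
    have "\<bar>g x\<bar> \<le> S / 2 + \<bar>g (2 * x)\<bar> / 2"
      using rec[of x] le_S[of "2 * x - 1"] by linarith
    also have "\<dots> \<le> S / 2 + ((1 - (1/2)^n) * S + (1/2)^n * \<bar>g (2^n * (2 * x))\<bar>) / 2"
      using Suc[of "2 * x"] by simp
    finally show ?case by (simp add: algebra_simps diff_divide_distrib add_divide_distrib)
  qed simp
  \<comment> \<open>The map \<open>2 * x - 1\<close> fixes 1, so writing points as
    \<open>1 + y\<close> turns its iteration into doubling of \<open>y\<close>.\<close>
  have left: "\<bar>g (1 + y)\<bar> \<le> (1 - (1/2)^n) * S + (1/2)^n * \<bar>g (1 + 2^n * y)\<bar>" for n y
  proof (induction n arbitrary: y)
    case (Suc n)
    have "\<bar>g (1 + y)\<bar> \<le> S / 2 + \<bar>g (1 + 2 * y)\<bar> / 2"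
      using rec[of "1 + y"] le_S[of "2 * (1 + y)"] by (simp add: algebra_simps)
    also have "\<dots> \<le> S / 2 + ((1 - (1/2)^n) * S + (1/2)^n * \<bar>g (1 + 2^n * (2 * y))\<bar>) / 2"
      using Suc[of "2 * y"] by simp
    finally show ?case by (simp add: algebra_simps diff_divide_distrib add_divide_distrib)
  qed simp
  have "S = 0"
  proof (rule ccontr)
    assume "S \<noteq> 0"
    with S_nonneg have "S > 0" by simp
    from order_tendstoD(2)[OF tendsto_rabs_zero[OF top], of "S/2"] \<open>S > 0\<close>
    obtain a where a: "\<And>x. x \<ge> a \<Longrightarrow> \<bar>g x\<bar> < S/2"
      by (auto simp: eventually_at_top_linorder)
    from order_tendstoD(2)[OF tendsto_rabs_zero[OF bot], of "S/2"] \<open>S > 0\<close>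
    obtain b where b: "\<And>x. x \<le> b \<Longrightarrow> \<bar>g x\<bar> < S/2"
      by (auto simp: eventually_at_bot_linorder)
    \<comment> \<open>With this many doublings every point from 1/2 onwards passes \<open>a\<close>
      under the first map, and every point before 1/2 drops below \<open>b\<close> under the
      second.\<close>
    obtain n where n: "2 * (\<bar>a\<bar> + \<bar>b\<bar> + 1) < 2 ^ n"
      using real_arch_pow[of 2] by auto
    have n_bounds: "a \<le> 2 ^ n / 2" "1 - 2 ^ n / 2 \<le> b"
      using n by argo+
    \<comment> \<open>This uniform bound falls short of \<open>S\<close> by
      \<open>(1/2)^n * S / 2\<close>, which contradicts \<open>S\<close> being the supremum.\<close>
    define c where "c = (1 - (1/2)^n) * S + (1/2)^n * (S/2)"
    have "\<bar>g x\<bar> \<le> c" for x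
    proof (cases "x \<ge> 1/2")
      case True
      then have "2^n * x \<ge> 2^n / 2" by simp
      then have "\<bar>g (2^n * x)\<bar> < S/2"
        using order_trans[OF n_bounds(1)] by (intro a)
      then have "(1/2)^n * \<bar>g (2^n * x)\<bar> \<le> (1/2)^n * (S/2)" by (intro mult_left_mono) auto
      with right[of x n] show ?thesis unfolding c_def by linarith
    next
      case False
      then have "2^n * (x - 1) \<le> 2^n * (-1/2)" by (intro mult_left_mono) auto
      then have "2^n * (x - 1) \<le> - (2^n / 2)" by simp
      then have "1 + 2^n * (x - 1) \<le> 1 - 2^n / 2" by linarith
      then have "\<bar>g (1 + 2^n * (x - 1))\<bar> < S/2"
        using order_trans[OF _ n_bounds(2)] by (intro b)
      then have "(1/2)^n * \<bar>g (1 + 2^n * (x - 1))\<bar> \<le> (1/2)^n * (S/2)"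
        by (intro mult_left_mono) auto
      moreover have "\<bar>g x\<bar> \<le> (1 - (1/2)^n) * S + (1/2)^n * \<bar>g (1 + 2^n * (x - 1))\<bar>"
        using left[of "x - 1" n] by simp
      ultimately show ?thesis unfolding c_def by linarith
    qed
    then have "S \<le> c"
      unfolding S_def by (intro cSUP_least) auto
    moreover have "c < S"
      using \<open>S > 0\<close> by (simp add: c_def field_simps)
    ultimately show False by simp
  qed
  with le_S[of x] show ?thesis by simp
qed

section \<open>Stationary distributions of the two binary-digit maps on the line\<close>

definition dyadic_stationary :: "real measure \<Rightarrow> bool" where
  "dyadic_stationary N \<longleftrightarrow>
     (\<forall>A\<in>sets borel. measure N A =
        (measure N ((\<lambda>x. x / 2) -` A) + measure N ((\<lambda>x. (x + 1) / 2) -` A)) / 2)"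

text \<open>Preimages of half-lines under the two maps are half-lines, so stationarity becomes a
  refinement equation for the distribution function. The difference of two such functions is bounded
  and vanishes at both ends, hence \<open>dyadic_refinement_zero\<close> applies.\<close>

lemma dyadic_stationary_unique:
  assumes "real_distribution N" "real_distribution N'"
    and "dyadic_stationary N" "dyadic_stationary N'"
  shows "N = N'"
proof -
  interpret N: real_distribution N by fact
  interpret N': real_distribution N' by fact
  have cdf_rec: "cdf K x = (cdf K (2 * x) + cdf K (2 * x - 1)) / 2" if "dyadic_stationary K" for K x
  proof -
    have "(\<lambda>y. y / 2) -` {..x} = {..2 * x}" "(\<lambda>y. (y + 1) / 2) -` {..x} = {..2 * x - 1}"
      by (auto simp: field_simps)
    with that show ?thesis
      unfolding dyadic_stationary_def cdf_def by (metis atMost_borel)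
  qed
  have "cdf N x - cdf N' x = 0" for x
  proof (rule dyadic_refinement_zero[where g = "\<lambda>x. cdf N x - cdf N' x"])
    fix x show "2 * (cdf N x - cdf N' x) =
        cdf N (2 * x) - cdf N' (2 * x) + (cdf N (2 * x - 1) - cdf N' (2 * x - 1))"
      using cdf_rec[OF assms(3), of x] cdf_rec[OF assms(4), of x] by (simp add: field_simps)
    have "norm (cdf N x - cdf N' x) \<le> 1" for x
      using N.cdf_nonneg[of x] N'.cdf_nonneg[of x] N.cdf_bounded_prob[of x] N'.cdf_bounded_prob[of x]
      by simp
    then show "bounded (range (\<lambda>x. cdf N x - cdf N' x))"
      by (auto simp: bounded_iff)
    show "((\<lambda>x. cdf N x - cdf N' x) \<longlongrightarrow> 0) at_top"
      using tendsto_diff[OF N.cdf_lim_at_top_prob N'.cdf_lim_at_top_prob] by simp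
    show "((\<lambda>x. cdf N x - cdf N' x) \<longlongrightarrow> 0) at_bot"
      using tendsto_diff[OF N.cdf_lim_at_bot N'.cdf_lim_at_bot] by simp
  qed
  then show ?thesis
    by (intro cdf_unique assms) auto
qed

text \<open>The half-open interval is split by its two halves without overlap, and winding it around
  the circle is injective.\<close>

definition unit_uniform :: "real measure" where
  "unit_uniform = uniform_measure lborel {0..<1}"

lemma sets_unit_uniform [simp, measurable_cong]: "sets unit_uniform = sets borel"
  by (simp add: unit_uniform_def)

lemma space_unit_uniform [simp]: "space unit_uniform = UNIV"
  by (simp add: unit_uniform_def)

lemma prob_space_unit_uniform: "prob_space unit_uniform"
  unfolding unit_uniform_def by (rule prob_space_uniform_measure) auto

lemma real_distribution_unit_uniform: "real_distribution unit_uniform"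
  using prob_space_unit_uniform by (simp add: real_distribution_def real_distribution_axioms_def)

lemma emeasure_unit_uniform:
  "A \<in> sets borel \<Longrightarrow> emeasure unit_uniform A = emeasure lborel ({0..<1} \<inter> A)"
  by (simp add: unit_uniform_def divide_ennreal_def)

lemma AE_unit_uniform: "AE x in unit_uniform. x \<in> {0..<1}"
  unfolding unit_uniform_def by (rule AE_uniform_measureI) auto

text \<open>Affine change of variables for \<open>x \<mapsto> (x + c) / 2\<close>, which maps the
  unit interval onto the half-length one; \<open>c = 0\<close> and \<open>c = 1\<close> give its two
  halves.\<close>

lemma emeasure_lborel_half:
  assumes "A \<in> sets borel"
  shows "emeasure lborel ({c/2..<(c+1)/2} \<inter> A) =
         ennreal (1/2) * emeasure lborel ({0..<1} \<inter> (\<lambda>x::real. (x + c) / 2) -` A)"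
proof -
  have m: "(\<lambda>x. c/2 + 1/2 * x) \<in> borel_measurable borel" by measurable
  have s: "{c/2..<(c+1)/2} \<inter> A \<in> sets borel" using assms by auto
  have "emeasure lborel ({c/2..<(c+1)/2} \<inter> A) =
        emeasure (density (distr lborel borel (\<lambda>x. c/2 + 1/2 * x)) (\<lambda>_. ennreal \<bar>1/2\<bar>)) ({c/2..<(c+1)/2} \<inter> A)"
    by (subst lborel_real_affine[of "1/2" "c/2"]) simp_all
  also have "\<dots> = ennreal (1/2) * emeasure (distr lborel borel (\<lambda>x. c/2 + 1/2 * x)) ({c/2..<(c+1)/2} \<inter> A)"
    using s by (subst emeasure_density_const) auto
  also have "\<dots> = ennreal (1/2) * emeasure lborel ((\<lambda>x. c/2 + 1/2 * x) -` ({c/2..<(c+1)/2} \<inter> A))"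
    using s m by (subst emeasure_distr) auto
  also have "(\<lambda>x. c/2 + 1/2 * x) -` ({c/2..<(c+1)/2} \<inter> A) = {0..<1} \<inter> (\<lambda>x. (x + c) / 2) -` A"
    by (auto simp: field_simps)
  finally show ?thesis .
qed

lemma dyadic_stationary_unit_uniform: "dyadic_stationary unit_uniform"
  unfolding dyadic_stationary_def
proof
  fix A :: "real set" assume A: "A \<in> sets borel"
  interpret U: prob_space unit_uniform by (rule prob_space_unit_uniform)
  have m: "(\<lambda>x::real. (x + c) / 2) -` A \<in> sets borel" for c
    using measurable_sets[of "\<lambda>x::real. (x + c) / 2" borel borel A] A by simp
  \<comment> \<open>The endpoints stay unsimplified so that \<open>emeasure_lborel_half\<close> can
    be rewritten with at \<open>c = 0\<close> and \<open>c = 1\<close>.\<close>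
  have "{0..<1} \<inter> A = ({0/2..<(0+1)/2} \<inter> A) \<union> ({1/2..<(1+1)/2} \<inter> A)" by auto
  then have "emeasure unit_uniform A = emeasure lborel (({0/2..<(0+1)/2} \<inter> A) \<union> ({1/2..<(1+1)/2} \<inter> A))"
    using A by (simp add: emeasure_unit_uniform)
  also have "\<dots> = emeasure lborel ({0/2..<(0+1)/2} \<inter> A) + emeasure lborel ({1/2..<(1+1)/2} \<inter> A)"
    using A by (intro plus_emeasure[symmetric]) auto
  also have "\<dots> = ennreal (1/2) * emeasure unit_uniform ((\<lambda>x. (x + 0) / 2) -` A)
      + ennreal (1/2) * emeasure unit_uniform ((\<lambda>x. (x + 1) / 2) -` A)"
    unfolding emeasure_lborel_half[OF A] by (simp only: emeasure_unit_uniform[OF m])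
  also have "\<dots> = ennreal (1/2 * measure unit_uniform ((\<lambda>x. (x + 0) / 2) -` A)
      + 1/2 * measure unit_uniform ((\<lambda>x. (x + 1) / 2) -` A))"
    by (simp only: U.emeasure_eq_measure flip: ennreal_mult')
      (rule ennreal_plus[symmetric], auto)
  finally have "ennreal (measure unit_uniform A) = \<dots>"
    by (simp only: U.emeasure_eq_measure)
  then show "measure unit_uniform A = (measure unit_uniform ((\<lambda>x. x / 2) -` A)
      + measure unit_uniform ((\<lambda>x. (x + 1) / 2) -` A)) / 2"
    by (subst (asm) ennreal_inj) (auto simp: field_simps)
qed

section \<open>The planar maps and their stationary measure\<close>

definition shear_half :: "real \<Rightarrow> real^2 \<Rightarrow> real^2" where
  "shear_half c x = vector [(x$1 + c) / 2 - x$2 / 4, x$2 / 2]"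

lemma shear_half_nth [simp]:
  "shear_half c x $ 1 = (x$1 + c) / 2 - x$2 / 4" "shear_half c x $ 2 = x$2 / 2"
  by (simp_all add: shear_half_def)

lemma borel_measurable_vector_2 [measurable (raw)]:
  fixes f g :: "'a \<Rightarrow> real"
  assumes [measurable]: "f \<in> borel_measurable M" "g \<in> borel_measurable M"
  shows "(\<lambda>x. vector [f x, g x] :: real^2) \<in> borel_measurable M"
proof -
  have eq: "(vector [a, b] :: real^2) = a *\<^sub>R axis 1 1 + b *\<^sub>R axis 2 1" for a b
    by (simp add: vec_eq_iff forall_2 axis_def)
  show ?thesis unfolding eq by measurable
qed

lemma borel_measurable_vec_nth [measurable]: "(\<lambda>x :: real^2. x $ i) \<in> borel_measurable borel"
  by (intro borel_measurable_continuous_onI continuous_intros)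

lemma shear_half_measurable [measurable]: "shear_half c \<in> borel_measurable borel"
  unfolding shear_half_def by measurable

text \<open>\<open>matrix_inv\<close> is a chosen two-sided inverse; associativity identifies it
  with any inverse that is exhibited.\<close>

lemma matrix_inv_unique:
  fixes A :: "'a::semiring_1^'n^'n"
  assumes "A ** B = mat 1" "B ** A = mat 1"
  shows "matrix_inv A = B"
proof -
  have "A ** matrix_inv A = mat 1 \<and> matrix_inv A ** A = mat 1"
    unfolding matrix_inv_def by (rule someI[of _ B]) (use assms in simp)
  then show ?thesis
    using assms(2) matrix_mul_assoc[of B A "matrix_inv A"] by simp
qed

lemma affine_contraction_shear:
  "affine_contraction (vector [vector [2, 1], vector [0, 2]]) (vector [c, 0]) = shear_half c"
proof
  fix x
  let ?R = "vector [vector [2, 1], vector [0, 2]] :: real^2^2"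
  let ?S = "vector [vector [1/2, -1/4], vector [0, 1/2]] :: real^2^2"
  have "?R ** ?S = mat 1" "?S ** ?R = mat 1"
    by (simp_all add: vec_eq_iff forall_2 matrix_matrix_mult_def sum_2 mat_def)
  then have inv: "matrix_inv ?R = ?S"
    by (rule matrix_inv_unique)
  show "affine_contraction ?R (vector [c, 0]) x = shear_half c x"
    unfolding affine_contraction_def inv
    by (simp add: vec_eq_iff forall_2 matrix_vector_mult_def sum_2 field_simps)
qed

definition shear_stationary :: "(real^2) measure \<Rightarrow> bool" where
  "shear_stationary \<mu> \<longleftrightarrow>
     (\<forall>E\<in>sets borel. measure \<mu> E =
        (measure \<mu> (shear_half 0 -` E) + measure \<mu> (shear_half 1 -` E)) / 2)"

text \<open>Both maps halve the second coordinate, so stationarity gives the strip complements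
  \<open>T a\<close> and \<open>T (2 * a)\<close> the same mass. Iterated doubling shrinks them to
  the empty set, and continuity from above forces that common mass to be 0.\<close>

lemma shear_stationary_second_zero:
  assumes sets: "sets \<mu> = sets borel" and "prob_space \<mu>" and st: "shear_stationary \<mu>"
  shows "AE x in \<mu>. x $ 2 = 0"
proof -
  interpret prob_space \<mu> by fact
  define T :: "real \<Rightarrow> (real^2) set" where "T a = {x. \<bar>x$2\<bar> > a}" for a
  have T: "T a \<in> sets borel" for a
    unfolding T_def by measurable
  have double: "measure \<mu> (T a) = measure \<mu> (T (2 * a))" for a
  proof -
    have "shear_half c -` T a = T (2 * a)" for c
      by (auto simp: T_def)
    then have "measure \<mu> (T a) = (measure \<mu> (T (2 * a)) + measure \<mu> (T (2 * a))) / 2"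
      using bspec[OF st[unfolded shear_stationary_def] T[of a]] by simp
    then show ?thesis by simp
  qed
  have "measure \<mu> (T a) = 0" if "a > 0" for a
  proof -
    have pow: "measure \<mu> (T a) = measure \<mu> (T (2^n * a))" for n
    proof (induction n)
      case (Suc n)
      then show ?case using double[of "2^n * a"] by (simp add: mult.assoc)
    qed simp
    have "decseq (\<lambda>n. T (2^n * a))"
    proof (rule decseq_SucI)
      fix n show "T (2 ^ Suc n * a) \<subseteq> T (2 ^ n * a)"
        using \<open>a > 0\<close> by (auto simp: T_def intro: less_trans[rotated])
    qed
    then have "(\<lambda>n. measure \<mu> (T (2^n * a))) \<longlonglongrightarrow> measure \<mu> (\<Inter>n. T (2^n * a))"
      using T by (intro finite_Lim_measure_decseq) (auto simp: sets)
    moreover have "(\<Inter>n. T (2^n * a)) = {}"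
    proof -
      have "\<exists>n. \<bar>x$2\<bar> \<le> 2^n * a" for x :: "real^2"
        using real_arch_pow[of 2 "\<bar>x$2\<bar> / a"] \<open>a > 0\<close> by (auto simp: field_simps intro: less_imp_le)
      then have "\<exists>n. x \<notin> T (2^n * a)" for x
        by (simp add: T_def not_less)
      then show ?thesis by blast
    qed
    ultimately have "(\<lambda>n::nat. measure \<mu> (T a)) \<longlonglongrightarrow> 0"
      by (simp flip: pow)
    then show ?thesis by (simp add: LIMSEQ_const_iff)
  qed
  then have "T (1 / real (Suc n)) \<in> null_sets \<mu>" for n
    using T by (auto simp: null_sets_def sets emeasure_eq_measure)
  then have "AE x in \<mu>. \<forall>n. x \<notin> T (1 / real (Suc n))"
    by (subst AE_all_countable) (auto intro: AE_not_in)
  then show ?thesis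
  proof eventually_elim
    case (elim x)
    show ?case
    proof (rule ccontr)
      assume "x $ 2 \<noteq> 0"
      then obtain n where "inverse (real (Suc n)) < \<bar>x$2\<bar>"
        using reals_Archimedean[of "\<bar>x$2\<bar>"] by auto
      with elim show False by (auto simp: T_def inverse_eq_divide)
    qed
  qed
qed

definition segment_measure :: "(real^2) measure" where
  "segment_measure = distr unit_uniform borel (\<lambda>a. vector [a, 0])"

lemma sets_segment_measure [simp, measurable_cong]: "sets segment_measure = sets borel"
  by (simp add: segment_measure_def)

lemma prob_space_segment_measure: "prob_space segment_measure"
  unfolding segment_measure_def
  by (rule prob_space.prob_space_distr[OF prob_space_unit_uniform]) measurable

lemma shear_stationary_segment_measure: "shear_stationary segment_measure"
  unfolding shear_stationary_def
proof
  fix E :: "(real^2) set" assume E: "E \<in> sets borel"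
  have meas: "measure segment_measure F = measure unit_uniform ((\<lambda>a. vector [a, 0]) -` F)"
    if "F \<in> sets borel" for F
    unfolding segment_measure_def using that by (subst measure_distr) auto
  have pre: "shear_half c -` E \<in> sets borel" for c
    using measurable_sets[OF shear_half_measurable E] by simp
  have ax: "(\<lambda>a. vector [a, 0] :: real^2) -` E \<in> sets borel"
    using measurable_sets[of "\<lambda>a. vector [a, 0] :: real^2" borel borel E] E by simp
  have comp: "(\<lambda>a. vector [a, 0]) -` (shear_half c -` E) =
      (\<lambda>x. (x + c) / 2) -` ((\<lambda>a. vector [a, 0]) -` E)" for c
    by (simp add: vimage_def shear_half_def)
  show "measure segment_measure E = (measure segment_measure (shear_half 0 -` E) +
      measure segment_measure (shear_half 1 -` E)) / 2"
    using dyadic_stationary_unit_uniform ax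
    by (simp add: meas E pre comp dyadic_stationary_def)
qed

text \<open>Almost everywhere the shear term vanishes, so the first marginal is stationary for the
  two maps on the line and therefore uniform. Almost every point equals
  \<open>vector [x $ 1, 0]\<close>, so the marginal determines the whole measure.\<close>

lemma shear_stationary_unique:
  assumes sets: "sets \<mu> = sets borel" and "prob_space \<mu>" and st: "shear_stationary \<mu>"
  shows "\<mu> = segment_measure"
proof -
  interpret prob_space \<mu> by fact
  have [measurable_cong]: "sets \<mu> = sets borel" by fact
  have space: "space \<mu> = UNIV" using sets_eq_imp_space_eq[OF sets] by simp
  have zero: "AE x in \<mu>. x $ 2 = 0"
    by (rule shear_stationary_second_zero) fact+
  define N where "N = distr \<mu> borel (\<lambda>x. x $ 1)"
  have N_meas: "measure N A = measure \<mu> ((\<lambda>x. x $ 1) -` A)" if "A \<in> sets borel" for A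
    unfolding N_def using that by (subst measure_distr) (auto simp: space)
  have pre: "(\<lambda>x::real. (x + c) / 2) -` A \<in> sets borel" if "A \<in> sets borel" for c A
    using measurable_sets[of "\<lambda>x::real. (x + c) / 2" borel borel A] that by simp
  have pre1: "(\<lambda>x::real^2. x $ 1) -` A \<in> sets borel" if "A \<in> sets borel" for A
    using measurable_sets[of "\<lambda>x::real^2. x $ 1" borel borel A] that by simp
  have "dyadic_stationary N"
    unfolding dyadic_stationary_def
  proof
    fix A :: "real set" assume A: "A \<in> sets borel"
    have "measure \<mu> (shear_half c -` ((\<lambda>x. x $ 1) -` A)) =
        measure \<mu> ((\<lambda>x. x $ 1) -` ((\<lambda>x. (x + c) / 2) -` A))" for c
    proof (rule finite_measure_eq_AE)
      show "AE x in \<mu>. (x \<in> shear_half c -` ((\<lambda>x. x $ 1) -` A)) \<longleftrightarrow>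
          (x \<in> (\<lambda>x. x $ 1) -` ((\<lambda>x. (x + c) / 2) -` A))"
        using zero by eventually_elim simp
      show "shear_half c -` ((\<lambda>x. x $ 1) -` A) \<in> sets \<mu>"
        using measurable_sets[OF shear_half_measurable pre1[OF A]] by (simp add: sets)
      show "(\<lambda>x. x $ 1) -` ((\<lambda>x. (x + c) / 2) -` A) \<in> sets \<mu>"
        using pre1[OF pre[OF A]] by (simp add: sets)
    qed
    note this[of 0] this[of 1]
    with st pre1[OF A] pre[OF A, of 0] pre[OF A, of 1] A
    show "measure N A = (measure N ((\<lambda>x. x / 2) -` A) + measure N ((\<lambda>x. (x + 1) / 2) -` A)) / 2"
      by (simp add: N_meas shear_stationary_def)
  qed
  moreover have "real_distribution N"
    unfolding N_def by (rule real_distribution_distr) measurable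
  ultimately have "N = unit_uniform"
    using dyadic_stationary_unique real_distribution_unit_uniform dyadic_stationary_unit_uniform
    by blast
  have "\<mu> = distr \<mu> borel (\<lambda>x. x)"
    by (rule distr_id2[symmetric]) (simp add: sets)
  also have "\<dots> = distr \<mu> borel (\<lambda>x. vector [x $ 1, 0])"
  proof (rule distr_cong_AE)
    show "AE x in \<mu>. x = vector [x $ 1, 0]"
      using zero by eventually_elim (simp add: vec_eq_iff forall_2)
  qed auto
  also have "\<dots> = distr N borel (\<lambda>a. vector [a, 0])"
    unfolding N_def by (subst distr_distr) (auto simp: comp_def)
  also have "\<dots> = segment_measure"
    by (simp add: \<open>N = unit_uniform\<close> segment_measure_def)
  finally show ?thesis .
qed

text \<open>Existence and uniqueness together resolve the definite description in
  \<open>self_affine_measure\<close>.\<close>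

lemma self_affine_measure_shear:
  "self_affine_measure (vector [vector [2, 1], vector [0, 2]]) {vector [0, 0], vector [1, 0]}
     = segment_measure"
proof -
  \<comment> \<open>Distinctness of the two digits is what makes the cardinality 2, hence each
    weight 1/2.\<close>
  have ne: "(vector [0, 0] :: real^2) \<noteq> vector [1, 0]"
    by (simp add: vec_eq_iff forall_2)
  have "(\<forall>E\<in>sets borel. measure \<mu> E =
      (\<Sum>b\<in>{vector [0, 0], vector [1, 0]}. 1 / real (card {vector [0, 0] :: real^2, vector [1, 0]}) *
        measure \<mu> (affine_contraction (vector [vector [2, 1], vector [0, 2]]) b -` E)))
    \<longleftrightarrow> shear_stationary \<mu>" for \<mu>
    using ne by (simp add: shear_stationary_def affine_contraction_shear add_divide_distrib)
  then show ?thesis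
    unfolding self_affine_measure_def
    using shear_stationary_unique shear_stationary_segment_measure prob_space_segment_measure
    by (intro the_equality) auto
qed


section \<open>Completeness of the characters on the unit interval\<close>

lemma square_integrable_bounded:
  assumes "finite_measure M" "f \<in> borel_measurable M" "\<And>x. cmod (f x) \<le> C"
  shows "square_integrable M f"
proof -
  interpret finite_measure M by fact
  have "integrable M (\<lambda>x. (cmod (f x))\<^sup>2)"
    using assms(2) by (intro integrable_const_bound[where B = "C\<^sup>2"] AE_I2)
      (simp_all add: power_mono assms(3))
  with assms(2) show ?thesis by (simp add: square_integrable_def)
qed

lemma norm_add_squared_le: "(norm (x + y))\<^sup>2 \<le> 2 * (norm x)\<^sup>2 + 2 * (norm y)\<^sup>2"
proof -
  have "(norm (x + y))\<^sup>2 \<le> (norm x + norm y)\<^sup>2"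
    by (intro power_mono norm_triangle_ineq) auto
  also have "\<dots> \<le> 2 * (norm x)\<^sup>2 + 2 * (norm y)\<^sup>2"
    using sum_squares_bound[of "norm x" "norm y"] by (simp add: power2_sum)
  finally show ?thesis .
qed

lemma square_integrable_add:
  assumes "square_integrable M f" "square_integrable M g"
  shows "square_integrable M (\<lambda>x. f x + g x)"
proof -
  have [measurable]: "f \<in> borel_measurable M" "g \<in> borel_measurable M"
    using assms by (auto simp: square_integrable_def)
  have "integrable M (\<lambda>x. (cmod (f x + g x))\<^sup>2)"
  proof (rule Bochner_Integration.integrable_bound)
    show "integrable M (\<lambda>x. 2 * (cmod (f x))\<^sup>2 + 2 * (cmod (g x))\<^sup>2)"
      using assms by (auto simp: square_integrable_def)
    show "AE x in M. norm ((cmod (f x + g x))\<^sup>2) \<le> norm (2 * (cmod (f x))\<^sup>2 + 2 * (cmod (g x))\<^sup>2)"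
      by (intro AE_I2) (simp add: norm_add_squared_le)
  qed measurable
  then show ?thesis by (simp add: square_integrable_def)
qed

lemma square_integrable_mult_const:
  "square_integrable M f \<Longrightarrow> square_integrable M (\<lambda>x. c * f x)"
  by (auto simp: square_integrable_def norm_mult power_mult_distrib)

lemma square_integrable_diff:
  "square_integrable M f \<Longrightarrow> square_integrable M g \<Longrightarrow> square_integrable M (\<lambda>x. f x - g x)"
  using square_integrable_add[of M f "\<lambda>x. -1 * g x"] square_integrable_mult_const[of M g "-1"] by simp

lemma integral_norm_add_squared_le:
  assumes "square_integrable M f" "square_integrable M g"
  shows "(LINT x|M. (cmod (f x + g x))\<^sup>2)
    \<le> 2 * (LINT x|M. (cmod (f x))\<^sup>2) + 2 * (LINT x|M. (cmod (g x))\<^sup>2)"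
proof -
  have "(LINT x|M. (cmod (f x + g x))\<^sup>2) \<le> (LINT x|M. 2 * (cmod (f x))\<^sup>2 + 2 * (cmod (g x))\<^sup>2)"
    using assms square_integrable_add[OF assms]
    by (intro integral_mono norm_add_squared_le) (auto simp: square_integrable_def)
  also have "\<dots> = 2 * (LINT x|M. (cmod (f x))\<^sup>2) + 2 * (LINT x|M. (cmod (g x))\<^sup>2)"
    using assms by (subst Bochner_Integration.integral_add) (auto simp: square_integrable_def)
  finally show ?thesis .
qed

section \<open>Characters and trigonometric polynomials\<close>

definition echar :: "int \<Rightarrow> real \<Rightarrow> complex" where
  "echar n a = cis (- 2 * pi * of_int n * a)"

text \<open>The inductive form gives closure properties by rule induction; the explicit finite sum
  with distinct frequencies is recovered in \<open>trig_poly_sum\<close>.\<close>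

inductive trig_poly :: "(real \<Rightarrow> complex) \<Rightarrow> bool" where
  trig_poly_echar: "trig_poly (\<lambda>a. c * echar n a)"
| trig_poly_add: "trig_poly p \<Longrightarrow> trig_poly q \<Longrightarrow> trig_poly (\<lambda>a. p a + q a)"

lemma echar_mult: "echar n a * echar m a = echar (n + m) a"
  by (simp add: echar_def cis_mult algebra_simps)

lemma cnj_echar: "cnj (echar n a) = echar (- n) a"
  by (simp add: echar_def cis_cnj)

lemma norm_echar [simp]: "cmod (echar n a) = 1"
  by (simp add: echar_def)

lemma echar_0: "echar 0 a = 1"
  by (simp add: echar_def)

lemma continuous_on_echar: "continuous_on S (echar n)"
  unfolding echar_def by (intro continuous_intros)

lemma echar_measurable [measurable]: "echar n \<in> borel_measurable borel"
  by (intro borel_measurable_continuous_onI continuous_on_echar)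

lemma trig_poly_const: "trig_poly (\<lambda>a. c)"
  using trig_poly_echar[of c 0] by (simp add: echar_0)

lemma trig_poly_mult:
  assumes "trig_poly p" "trig_poly q"
  shows "trig_poly (\<lambda>a. p a * q a)"
  using assms(1)
proof induction
  case (trig_poly_echar c n)
  from assms(2) show ?case
  proof induction
    case (trig_poly_echar d m)
    have "(\<lambda>a. c * echar n a * (d * echar m a)) = (\<lambda>a. (c * d) * echar (n + m) a)"
      by (simp add: mult_ac flip: echar_mult)
    then show ?case by (simp only: trig_poly.trig_poly_echar)
  next
    case (trig_poly_add p q)
    then show ?case by (simp only: distrib_left trig_poly.trig_poly_add)
  qed
next
  case (trig_poly_add p p')
  then show ?case by (simp only: distrib_right trig_poly.trig_poly_add)
qed

lemma trig_poly_sum: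
  assumes "trig_poly p"
  obtains F c where "finite F" "p = (\<lambda>a. \<Sum>n\<in>F. c n * echar n a)"
proof -
  have "\<exists>F c. finite F \<and> p = (\<lambda>a. \<Sum>n\<in>F. c n * echar n a)"
    using assms
  proof induction
    case (trig_poly_echar c n)
    show ?case by (intro exI[of _ "{n}"] exI[of _ "\<lambda>_. c"]) simp
  next
    case (trig_poly_add p q)
    then obtain F c G d where *: "finite F" "p = (\<lambda>a. \<Sum>n\<in>F. c n * echar n a)"
      "finite G" "q = (\<lambda>a. \<Sum>n\<in>G. d n * echar n a)" by blast
    \<comment> \<open>Extending both coefficient families by 0 to \<open>F \<union> G\<close> allows
      termwise addition.\<close>
    define c' where "c' n = (if n \<in> F then c n else 0)" for n
    define d' where "d' n = (if n \<in> G then d n else 0)" for n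
    have "p = (\<lambda>a. \<Sum>n\<in>F \<union> G. c' n * echar n a)" "q = (\<lambda>a. \<Sum>n\<in>F \<union> G. d' n * echar n a)"
      using *(1,3) unfolding *(2,4)
      by (auto simp: c'_def d'_def intro!: ext sum.mono_neutral_cong_left)
    then have "(\<lambda>a. p a + q a) = (\<lambda>a. \<Sum>n\<in>F \<union> G. (c' n + d' n) * echar n a)"
      by (simp add: sum.distrib distrib_right)
    then show ?case
      using *(1,3) by (intro exI[of _ "F \<union> G"] exI[of _ "\<lambda>n. c' n + d' n"]) auto
  qed
  then show thesis using that by blast
qed

lemma trig_poly_continuous_on: "trig_poly p \<Longrightarrow> continuous_on S p"
  by (induction rule: trig_poly.induct)
    (simp_all add: continuous_on_mult continuous_on_add continuous_on_echar)

lemma trig_poly_square_integrable: "trig_poly p \<Longrightarrow> square_integrable unit_uniform p"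
proof (induction rule: trig_poly.induct)
  case (trig_poly_echar c n)
  show ?case
    by (rule square_integrable_bounded[where C = "cmod c"])
      (use prob_space.finite_measure[OF prob_space_unit_uniform] in \<open>auto simp: norm_mult\<close>)
qed (rule square_integrable_add)

text \<open>On the circle a real-linear function is a combination of cosine and sine, hence of
  \<open>echar 1\<close> and \<open>echar (-1)\<close>; sums and products then follow by closure.
  This makes the Stone-Weierstrass theorem for real polynomials applicable to trigonometric
  approximation.\<close>

lemma real_polynomial_circle_trig_poly:
  fixes p :: "complex \<Rightarrow> real"
  assumes "real_polynomial_function p"
  shows "trig_poly (\<lambda>a. complex_of_real (p (cis (2 * pi * a))))"
  using assms
proof induction
  case (linear f)
  interpret bounded_linear f by fact
  have "f (cis (2 * pi * a)) = cos (2 * pi * a) * f 1 + sin (2 * pi * a) * f \<i>" for a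
  proof -
    have "cis (2 * pi * a) = cos (2 * pi * a) *\<^sub>R 1 + sin (2 * pi * a) *\<^sub>R \<i>"
      by (simp add: complex_eq_iff)
    then show ?thesis by (simp only: add scaleR) simp
  qed
  \<comment> \<open>Euler's formulas; as \<open>echar 1 a\<close> is the conjugate of
    \<open>cis (2 * pi * a)\<close>, the signs for the sine are interchanged.\<close>
  moreover have "complex_of_real (cos (2 * pi * a)) = 1/2 * echar 1 a + 1/2 * echar (-1) a"
    "complex_of_real (sin (2 * pi * a)) = \<i>/2 * echar 1 a + -\<i>/2 * echar (-1) a" for a
    by (simp_all add: echar_def complex_eq_iff)
  ultimately have "(\<lambda>a. complex_of_real (f (cis (2 * pi * a)))) =
      (\<lambda>a. (1/2 * echar 1 a + 1/2 * echar (-1) a) * complex_of_real (f 1)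
         + (\<i>/2 * echar 1 a + -\<i>/2 * echar (-1) a) * complex_of_real (f \<i>))"
    by (simp only: of_real_add of_real_mult)
  then show ?case
    by (simp only:) (intro trig_poly_add trig_poly_mult trig_poly_echar trig_poly_const)
qed (simp_all only: of_real_add of_real_mult trig_poly_add trig_poly_mult trig_poly_const)

text \<open>Membership in the \<open>L2\<close> closure of the trigonometric polynomials, with
  squared norms to avoid roots. Square-integrability is part of it because the integral of a
  non-integrable function is 0 by convention, so a small value alone would say nothing.\<close>

definition trig_approximable :: "(real \<Rightarrow> complex) \<Rightarrow> bool" where
  "trig_approximable f \<longleftrightarrow> square_integrable unit_uniform f \<and>
     (\<forall>\<epsilon>>0. \<exists>p. trig_poly p \<and> (LINT a|unit_uniform. (cmod (f a - p a))\<^sup>2) < \<epsilon>)"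

lemma trig_approximableE:
  assumes "trig_approximable f" "\<epsilon> > 0"
  obtains p where "trig_poly p" "(LINT a|unit_uniform. (cmod (f a - p a))\<^sup>2) < \<epsilon>"
  using assms unfolding trig_approximable_def by blast

lemma trig_approximable_limit:
  assumes f: "square_integrable unit_uniform f"
    and lim: "\<And>\<epsilon>. \<epsilon> > 0 \<Longrightarrow> \<exists>g. trig_approximable g \<and> (LINT a|unit_uniform. (cmod (f a - g a))\<^sup>2) < \<epsilon>"
  shows "trig_approximable f"
  unfolding trig_approximable_def
proof (intro conjI allI impI f)
  fix \<epsilon> :: real assume "\<epsilon> > 0"
  \<comment> \<open>A quarter of the error for each part, since splitting a squared norm costs a
    factor 2 on both terms.\<close>
  then obtain g where g: "trig_approximable g" "(LINT a|unit_uniform. (cmod (f a - g a))\<^sup>2) < \<epsilon>/4"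
    using lim[of "\<epsilon>/4"] by auto
  obtain p where p: "trig_poly p" "(LINT a|unit_uniform. (cmod (g a - p a))\<^sup>2) < \<epsilon>/4"
    using trig_approximableE[OF g(1), of "\<epsilon>/4"] \<open>\<epsilon> > 0\<close> by auto
  have sq: "square_integrable unit_uniform g"
    using g by (simp add: trig_approximable_def)
  have "(LINT a|unit_uniform. (cmod (f a - p a))\<^sup>2)
      = (LINT a|unit_uniform. (cmod ((f a - g a) + (g a - p a)))\<^sup>2)" by simp
  also have "\<dots> \<le> 2 * (LINT a|unit_uniform. (cmod (f a - g a))\<^sup>2)
      + 2 * (LINT a|unit_uniform. (cmod (g a - p a))\<^sup>2)"
    by (intro integral_norm_add_squared_le square_integrable_diff f sq trig_poly_square_integrable p)
  also have "\<dots> < \<epsilon>" using g p by simp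
  finally show "\<exists>p. trig_poly p \<and> (LINT a|unit_uniform. (cmod (f a - p a))\<^sup>2) < \<epsilon>"
    using p by blast
qed

lemma trig_approximable_add:
  assumes f: "trig_approximable f" and g: "trig_approximable g"
  shows "trig_approximable (\<lambda>a. f a + g a)"
  unfolding trig_approximable_def
proof (intro conjI allI impI)
  have sq: "square_integrable unit_uniform f" "square_integrable unit_uniform g"
    using f g by (simp_all add: trig_approximable_def)
  then show "square_integrable unit_uniform (\<lambda>a. f a + g a)"
    by (rule square_integrable_add)
  fix \<epsilon> :: real assume "\<epsilon> > 0"
  then have "\<epsilon>/4 > 0" by simp
  obtain p where p: "trig_poly p" "(LINT a|unit_uniform. (cmod (f a - p a))\<^sup>2) < \<epsilon>/4"
    using trig_approximableE[OF f \<open>\<epsilon>/4 > 0\<close>] .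
  obtain q where q: "trig_poly q" "(LINT a|unit_uniform. (cmod (g a - q a))\<^sup>2) < \<epsilon>/4"
    using trig_approximableE[OF g \<open>\<epsilon>/4 > 0\<close>] .
  have "(LINT a|unit_uniform. (cmod (f a + g a - (p a + q a)))\<^sup>2)
      = (LINT a|unit_uniform. (cmod ((f a - p a) + (g a - q a)))\<^sup>2)" by (simp add: algebra_simps)
  also have "\<dots> \<le> 2 * (LINT a|unit_uniform. (cmod (f a - p a))\<^sup>2)
      + 2 * (LINT a|unit_uniform. (cmod (g a - q a))\<^sup>2)"
    by (intro integral_norm_add_squared_le square_integrable_diff sq trig_poly_square_integrable p q)
  also have "\<dots> < \<epsilon>" using p q by simp
  finally show "\<exists>p. trig_poly p \<and> (LINT a|unit_uniform. (cmod (f a + g a - p a))\<^sup>2) < \<epsilon>"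
    using trig_poly_add[OF p(1) q(1)] by blast
qed

lemma trig_approximable_mult_const:
  assumes f: "trig_approximable f"
  shows "trig_approximable (\<lambda>a. c * f a)"
  unfolding trig_approximable_def
proof (intro conjI allI impI)
  show "square_integrable unit_uniform (\<lambda>a. c * f a)"
    using f by (simp add: trig_approximable_def square_integrable_mult_const)
  fix \<epsilon> :: real assume "\<epsilon> > 0"
  \<comment> \<open>Adding 1 keeps the divisor positive when \<open>c = 0\<close>.\<close>
  have pos: "(cmod c)\<^sup>2 + 1 > 0" by (simp add: add_nonneg_pos)
  with \<open>\<epsilon> > 0\<close> have "\<epsilon> / ((cmod c)\<^sup>2 + 1) > 0" by simp
  then obtain p where p: "trig_poly p"
      "(LINT a|unit_uniform. (cmod (f a - p a))\<^sup>2) < \<epsilon> / ((cmod c)\<^sup>2 + 1)"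
    using trig_approximableE[OF f] by blast
  let ?I = "LINT a|unit_uniform. (cmod (f a - p a))\<^sup>2"
  have "(LINT a|unit_uniform. (cmod (c * f a - c * p a))\<^sup>2) = (cmod c)\<^sup>2 * ?I"
    by (simp add: norm_mult power_mult_distrib flip: right_diff_distrib)
  also have "\<dots> \<le> ((cmod c)\<^sup>2 + 1) * ?I"
    by (intro mult_right_mono) auto
  also have "\<dots> < \<epsilon>"
    using p(2) by (subst mult.commute) (simp only: pos_less_divide_eq[OF pos])
  finally show "\<exists>p. trig_poly p \<and> (LINT a|unit_uniform. (cmod (c * f a - p a))\<^sup>2) < \<epsilon>"
    using trig_poly_mult[OF trig_poly_const p(1)] by blast
qed

lemma trig_approximable_0: "trig_approximable (\<lambda>_. 0)"
  using trig_poly_const[of 0] trig_poly_square_integrable[OF trig_poly_const[of 0]]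
  unfolding trig_approximable_def by (auto intro!: exI[of _ "\<lambda>_. 0"])

lemma trig_approximable_sum:
  assumes "finite I" "\<And>i. i \<in> I \<Longrightarrow> trig_approximable (f i)"
  shows "trig_approximable (\<lambda>a. \<Sum>i\<in>I. f i a)"
  using assms by (induction I) (simp_all add: trig_approximable_add trig_approximable_0)

text \<open>Stone-Weierstrass on the unit circle gives uniform approximation by real polynomials,
  whose pullbacks are trigonometric polynomials. Since the total mass is 1, a uniform error
  \<open>\<delta>\<close> contributes at most its square to the integral.\<close>

lemma trig_approximable_circle:
  fixes h :: "complex \<Rightarrow> real"
  assumes h: "continuous_on UNIV h"
  shows "trig_approximable (\<lambda>a. complex_of_real (h (cis (2 * pi * a))))"
proof -
  interpret U: prob_space unit_uniform by (rule prob_space_unit_uniform)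
  have cis: "cis (2 * pi * a) \<in> sphere 0 1" for a by simp
  have [measurable]: "(\<lambda>a. h (cis (2 * pi * a))) \<in> borel_measurable borel"
    by (intro borel_measurable_continuous_onI continuous_on_compose2[OF h] continuous_intros) auto
  have "compact (h ` sphere 0 1)"
    by (intro compact_continuous_image continuous_on_subset[OF h]) auto
  then have "bounded (h ` sphere 0 1)" by (rule compact_imp_bounded)
  then obtain C where "\<forall>y\<in>h ` sphere 0 1. norm y \<le> C"
    unfolding bounded_iff by blast
  then have C: "\<bar>h z\<bar> \<le> C" if "z \<in> sphere 0 1" for z
    using that by simp
  have sq: "square_integrable unit_uniform (\<lambda>a. complex_of_real (h (cis (2 * pi * a))))"
  proof (rule square_integrable_bounded[where C = C])
    show "finite_measure unit_uniform" by (rule U.finite_measure_axioms)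
    show "cmod (complex_of_real (h (cis (2 * pi * a)))) \<le> C" for a
      using C[OF cis] by simp
  qed measurable
  show ?thesis
    unfolding trig_approximable_def
  proof (intro conjI allI impI sq)
    fix \<epsilon> :: real assume "\<epsilon> > 0"
    define \<delta> where "\<delta> = sqrt (\<epsilon> / 2)"
    have "\<delta> > 0" "\<delta>\<^sup>2 < \<epsilon>" using \<open>\<epsilon> > 0\<close> by (simp_all add: \<delta>_def)
    obtain g where g: "real_polynomial_function g" "\<And>z. z \<in> sphere 0 1 \<Longrightarrow> \<bar>h z - g z\<bar> < \<delta>"
      using Stone_Weierstrass_real_polynomial_function[OF compact_sphere continuous_on_subset[OF h subset_UNIV] \<open>\<delta> > 0\<close>]
      by blast
    let ?p = "\<lambda>a. complex_of_real (g (cis (2 * pi * a)))"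
    have p: "trig_poly ?p" by (rule real_polynomial_circle_trig_poly) fact
    have "(LINT a|unit_uniform. (cmod (complex_of_real (h (cis (2 * pi * a))) - ?p a))\<^sup>2)
        \<le> (LINT a|unit_uniform. \<delta>\<^sup>2)"
    proof (rule integral_mono)
      show "integrable unit_uniform (\<lambda>a. (cmod (complex_of_real (h (cis (2 * pi * a))) - ?p a))\<^sup>2)"
        using square_integrable_diff[OF sq trig_poly_square_integrable[OF p]]
        by (simp add: square_integrable_def)
      fix a
      have "cmod (complex_of_real (h (cis (2 * pi * a))) - ?p a) \<le> \<delta>"
        using g(2)[OF cis, of a] by (simp flip: of_real_diff)
      then show "(cmod (complex_of_real (h (cis (2 * pi * a))) - ?p a))\<^sup>2 \<le> \<delta>\<^sup>2"
        by (intro power_mono) auto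
    qed simp
    also have "\<dots> = \<delta>\<^sup>2" using U.prob_space by simp
    also note \<open>\<delta>\<^sup>2 < \<epsilon>\<close>
    finally show "\<exists>p. trig_poly p \<and>
        (LINT a|unit_uniform. (cmod (complex_of_real (h (cis (2 * pi * a))) - p a))\<^sup>2) < \<epsilon>"
      using p by blast
  qed
qed

text \<open>The two angles differ by less than a full turn, and \<open>exp\<close> separates points
  whose imaginary parts are that close.\<close>

lemma cis_inj_unit:
  assumes "a \<in> {0..<1}" "b \<in> {0..<1}" "cis (2 * pi * a) = cis (2 * pi * b)"
  shows "a = b"
proof -
  have "2 * pi * \<bar>a - b\<bar> < 2 * pi * 1"
    using assms by (intro mult_strict_left_mono) auto
  moreover have "2 * pi * a - 2 * pi * b = 2 * pi * (a - b)"
    by (simp add: right_diff_distrib)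
  ultimately have "\<bar>2 * pi * a - 2 * pi * b\<bar> < 2 * pi"
    by (simp only: abs_mult) simp
  then have "\<bar>Im (\<i> * complex_of_real (2 * pi * a)) - Im (\<i> * complex_of_real (2 * pi * b))\<bar> < 2 * pi"
    by (simp only: Im_i_times Re_complex_of_real)
  then have "\<i> * complex_of_real (2 * pi * a) = \<i> * complex_of_real (2 * pi * b)"
    using assms(3) unfolding cis_conv_exp by (rule exp_complex_eqI)
  then have "Re (complex_of_real (2 * pi * a)) = Re (complex_of_real (2 * pi * b))"
    by (metis complex_i_not_zero mult_cancel_left)
  then show ?thesis by simp
qed


lemma borel_measurable_unit_uniform [simp]: "borel_measurable unit_uniform = borel_measurable borel"
  by (rule measurable_cong_sets) simp_all

lemma borel_measurable_segment_measure [simp]: "borel_measurable segment_measure = borel_measurable borel"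
  by (rule measurable_cong_sets) simp_all

text \<open>The image \<open>C\<close> of \<open>K\<close> on the circle is closed, so continuous
  cutoffs of the distance to \<open>C\<close> converge pointwise on the unit interval to the
  indicator of \<open>K\<close>. Dominated convergence with majorant 1 turns this into
  \<open>L2\<close> convergence.\<close>

lemma trig_approximable_indicator_compact:
  fixes K :: "real set"
  assumes K: "compact K" "K \<subseteq> {0..<1}"
  shows "trig_approximable (indicator K)"
\<comment> \<open>The empty set is treated apart because \<open>infdist\<close> to it is 0 by
  convention, which would make every cutoff constantly 1.\<close>
proof (cases "K = {}")
  case True
  then have "(indicator K :: real \<Rightarrow> complex) = (\<lambda>_. 0)" by (simp add: fun_eq_iff)
  then show ?thesis using trig_approximable_0 by simp
next
  case False
  interpret U: prob_space unit_uniform by (rule prob_space_unit_uniform)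
  define C where "C = (\<lambda>a. cis (2 * pi * a)) ` K"
  have C: "closed C" "C \<noteq> {}"
    using False K unfolding C_def
    by (auto intro!: compact_imp_closed compact_continuous_image continuous_intros)
  \<comment> \<open>A tent that is 1 on \<open>C\<close> and, for positive \<open>n\<close>,
    vanishes at distance \<open>1 / n\<close> and beyond.\<close>
  define h where "h n z = max 0 (1 - real n * infdist z C)" for n z
  have h_cont: "continuous_on UNIV (h n)" for n
    unfolding h_def by (intro continuous_intros)
  let ?g = "\<lambda>n a. complex_of_real (h n (cis (2 * pi * a)))"
  have g: "trig_approximable (?g n)" for n
    by (rule trig_approximable_circle) (rule h_cont)
  have [measurable]: "?g n \<in> borel_measurable borel" for n
    using g[of n] by (simp add: trig_approximable_def square_integrable_def)
  have [measurable]: "K \<in> sets borel"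
    using K by (simp add: borel_compact)
  have range: "0 \<le> h n z" "h n z \<le> 1" for n z
    using infdist_nonneg[of z C] by (simp_all add: h_def)
  have "(\<lambda>n. LINT a|unit_uniform. (cmod (indicator K a - ?g n a))\<^sup>2) \<longlonglongrightarrow> (LINT a|unit_uniform. 0)"
  proof (rule integral_dominated_convergence[where w = "\<lambda>_. 1"])
    show "AE a in unit_uniform. (\<lambda>n. (cmod (indicator K a - ?g n a))\<^sup>2) \<longlonglongrightarrow> 0"
      using AE_unit_uniform
    proof eventually_elim
      case (elim a)
      have "\<forall>\<^sub>F n in sequentially. h n (cis (2 * pi * a)) = indicator K a"
      proof (cases "a \<in> K")
        case True
        then have "cis (2 * pi * a) \<in> C" by (auto simp: C_def)
        with True show ?thesis by (simp add: h_def)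
      next
        case False
        then have "cis (2 * pi * a) \<notin> C"
          unfolding C_def using cis_inj_unit[OF elim] K(2) by blast
        with C have "infdist (cis (2 * pi * a)) C > 0"
          by (intro infdist_pos_not_in_closed)
        then obtain N where N: "1 < real N * infdist (cis (2 * pi * a)) C"
          using ex_less_of_nat_mult by blast
        have "h n (cis (2 * pi * a)) = 0" if "n \<ge> N" for n
        proof -
          have "real N * infdist (cis (2 * pi * a)) C \<le> real n * infdist (cis (2 * pi * a)) C"
            using that by (intro mult_right_mono infdist_nonneg) auto
          with N show ?thesis by (simp add: h_def)
        qed
        with False show ?thesis by (auto simp: eventually_sequentially)
      qed
      then have "\<forall>\<^sub>F n in sequentially. (cmod (indicator K a - ?g n a))\<^sup>2 = 0"
        by eventually_elim (simp add: indicator_def)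
      then show ?case by (rule tendsto_eventually)
    qed
    fix n
    have "(cmod (indicator K a - ?g n a))\<^sup>2 \<le> 1" for a
    proof -
      have "indicator K a - ?g n a = complex_of_real (indicator K a - h n (cis (2 * pi * a)))"
        by (simp add: indicator_def)
      then have "cmod (indicator K a - ?g n a) = \<bar>indicator K a - h n (cis (2 * pi * a))\<bar>"
        by (simp only: norm_of_real)
      also have "\<dots> \<le> 1"
        using range[of n "cis (2 * pi * a)"] by (simp add: indicator_def)
      finally show ?thesis by (simp add: power_le_one)
    qed
    then show "AE a in unit_uniform. norm ((cmod (indicator K a - ?g n a))\<^sup>2) \<le> 1"
      by simp
  qed auto
  then have lim: "(\<lambda>n. LINT a|unit_uniform. (cmod (indicator K a - ?g n a))\<^sup>2) \<longlonglongrightarrow> 0"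
    by simp
  show ?thesis
  proof (rule trig_approximable_limit)
    show "square_integrable unit_uniform (indicator K)"
      by (rule square_integrable_bounded[where C = 1]) (simp_all add: U.finite_measure_axioms indicator_def)
    fix \<epsilon> :: real assume "\<epsilon> > 0"
    from order_tendstoD(2)[OF lim this]
    obtain n where "(LINT a|unit_uniform. (cmod (indicator K a - ?g n a))\<^sup>2) < \<epsilon>"
      by (auto simp: eventually_sequentially)
    with g[of n] show "\<exists>g. trig_approximable g \<and>
        (LINT a|unit_uniform. (cmod (indicator K a - g a))\<^sup>2) < \<epsilon>"
      by blast
  qed
qed

text \<open>Inner regularity supplies a compact subset of nearly full measure; the squared distance
  of the two indicators is the measure of what is left out.\<close>

lemma trig_approximable_indicator:
  fixes A :: "real set"
  assumes [measurable]: "A \<in> sets borel"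
  shows "trig_approximable (indicator A)"
proof (rule trig_approximable_limit)
  interpret U: prob_space unit_uniform by (rule prob_space_unit_uniform)
  show "square_integrable unit_uniform (indicator A)"
    by (rule square_integrable_bounded[where C = 1]) (simp_all add: U.finite_measure_axioms indicator_def)
  fix \<epsilon> :: real assume "\<epsilon> > 0"
  let ?B = "A \<inter> {0..<1}"
  have "\<exists>K. K \<subseteq> ?B \<and> compact K \<and> measure unit_uniform ?B - \<epsilon> < measure unit_uniform K"
  \<comment> \<open>\<open>ennreal\<close> truncates negative numbers to 0, so a negative bound is
    handled separately, with the empty set as witness.\<close>
  proof (cases "measure unit_uniform ?B - \<epsilon> < 0")
    case True
    then show ?thesis by (intro exI[of _ "{}"]) auto
  next
    case False
    have "ennreal (measure unit_uniform ?B - \<epsilon>) < emeasure unit_uniform ?B"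
      using False \<open>\<epsilon> > 0\<close> by (simp add: U.emeasure_eq_measure ennreal_less_iff)
    also have "emeasure unit_uniform ?B = (SUP K\<in>{K. K \<subseteq> ?B \<and> compact K}. emeasure unit_uniform K)"
      by (rule inner_regular) (simp_all add: U.emeasure_eq_measure)
    finally obtain K where "K \<subseteq> ?B" "compact K"
        "ennreal (measure unit_uniform ?B - \<epsilon>) < emeasure unit_uniform K"
      by (auto simp: less_SUP_iff)
    with False show ?thesis
      by (intro exI[of _ K]) (simp add: U.emeasure_eq_measure ennreal_less_iff)
  qed
  then obtain K where K: "K \<subseteq> ?B" "compact K" "measure unit_uniform ?B - \<epsilon> < measure unit_uniform K"
    by blast
  have [measurable]: "K \<in> sets borel"
    using K by (simp add: borel_compact)
  have "(LINT a|unit_uniform. (cmod (indicator A a - indicator K a))\<^sup>2)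
      = (LINT a|unit_uniform. indicator (?B - K) a)"
  proof (rule integral_cong_AE)
    show "AE a in unit_uniform. (cmod (indicator A a - indicator K a))\<^sup>2 = indicator (?B - K) a"
      using AE_unit_uniform by eventually_elim (use K in \<open>auto simp: indicator_def\<close>)
  qed measurable
  also have "\<dots> = measure unit_uniform (?B - K)" by simp
  also have "\<dots> = measure unit_uniform ?B - measure unit_uniform K"
    using K by (intro U.finite_measure_Diff) auto
  also have "\<dots> < \<epsilon>" using K by simp
  finally show "\<exists>g. trig_approximable g \<and>
      (LINT a|unit_uniform. (cmod (indicator A a - g a))\<^sup>2) < \<epsilon>"
    using trig_approximable_indicator_compact[of K] K by blast
qed

lemma trig_approximable_simple:
  assumes f: "simple_function unit_uniform f"
  shows "trig_approximable f"
proof -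
  have "f = (\<lambda>x. \<Sum>y \<in> range f. y * indicator (f -` {y}) x)"
  proof
    fix x
    have "(\<Sum>y \<in> range f. y * indicator (f -` {y}) x) = (\<Sum>y \<in> range f. if f x = y then y else 0)"
      by (intro sum.cong) (auto simp: indicator_def)
    also have "\<dots> = f x"
      using simple_functionD(1)[OF f] by (simp add: sum.delta')
    finally show "f x = (\<Sum>y \<in> range f. y * indicator (f -` {y}) x)" ..
  qed
  moreover have "trig_approximable (\<lambda>x. \<Sum>y \<in> range f. y * indicator (f -` {y}) x)"
    using simple_functionD[OF f]
    by (intro trig_approximable_sum trig_approximable_mult_const trig_approximable_indicator) auto
  ultimately show ?thesis by simp
qed

text \<open>Simple functions \<open>F n\<close> converge pointwise to \<open>f\<close> with norm at
  most twice that of \<open>f\<close>. The differences have norm at most three times that of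
  \<open>f\<close>, so \<open>9 * (cmod (f a))\<^sup>2\<close> is an integrable majorant.\<close>

lemma square_integrable_trig_approximable:
  assumes f: "square_integrable unit_uniform f"
  shows "trig_approximable f"
proof (rule trig_approximable_limit[OF f])
  have [measurable]: "f \<in> borel_measurable borel" and int: "integrable unit_uniform (\<lambda>a. (cmod (f a))\<^sup>2)"
    using f by (simp_all add: square_integrable_def)
  have "f \<in> borel_measurable unit_uniform" by measurable
  from borel_measurable_implies_sequence_metric[OF this, of 0]
  obtain F where F: "\<And>i. simple_function unit_uniform (F i)" "\<And>x. (\<lambda>i. F i x) \<longlonglongrightarrow> f x"
      "\<And>i x. cmod (F i x) \<le> 2 * cmod (f x)"
    by auto
  have [measurable]: "F i \<in> borel_measurable borel" for i
    using borel_measurable_simple_function[OF F(1)[of i]] by simp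
  have "(\<lambda>n. LINT a|unit_uniform. (cmod (f a - F n a))\<^sup>2) \<longlonglongrightarrow> (LINT a|unit_uniform. 0)"
  proof (rule integral_dominated_convergence[where w = "\<lambda>a. 9 * (cmod (f a))\<^sup>2"])
    show "AE a in unit_uniform. (\<lambda>n. (cmod (f a - F n a))\<^sup>2) \<longlonglongrightarrow> 0"
    proof (rule AE_I2)
      fix a
      have "(\<lambda>n. (cmod (f a - F n a))\<^sup>2) \<longlonglongrightarrow> (cmod (f a - f a))\<^sup>2"
        by (intro tendsto_intros F)
      then show "(\<lambda>n. (cmod (f a - F n a))\<^sup>2) \<longlonglongrightarrow> 0" by simp
    qed
    fix n
    have "(cmod (f a - F n a))\<^sup>2 \<le> 9 * (cmod (f a))\<^sup>2" for a
    proof -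
      have "cmod (f a - F n a) \<le> 3 * cmod (f a)"
        using norm_triangle_ineq4[of "f a" "F n a"] F(3)[of n a] by simp
      then have "(cmod (f a - F n a))\<^sup>2 \<le> (3 * cmod (f a))\<^sup>2"
        by (intro power_mono) auto
      then show ?thesis by (simp add: power_mult_distrib)
    qed
    then show "AE a in unit_uniform. norm ((cmod (f a - F n a))\<^sup>2) \<le> 9 * (cmod (f a))\<^sup>2"
      by simp
  qed (use int in auto)
  then have lim: "(\<lambda>n. LINT a|unit_uniform. (cmod (f a - F n a))\<^sup>2) \<longlonglongrightarrow> 0"
    by simp
  fix \<epsilon> :: real assume "\<epsilon> > 0"
  from order_tendstoD(2)[OF lim this]
  obtain n where "(LINT a|unit_uniform. (cmod (f a - F n a))\<^sup>2) < \<epsilon>"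
    by (auto simp: eventually_sequentially)
  with trig_approximable_simple[OF F(1)[of n]]
  show "\<exists>g. trig_approximable g \<and> (LINT a|unit_uniform. (cmod (f a - g a))\<^sup>2) < \<epsilon>"
    by blast
qed

section \<open>Orthonormality, and transfer of the basis to the plane\<close>

lemma integral_echar: "(LINT a|unit_uniform. echar n a) = (if n = 0 then 1 else 0)"
proof (cases "n = 0")
  case True
  interpret U: prob_space unit_uniform by (rule prob_space_unit_uniform)
  show ?thesis using True U.prob_space by (simp add: echar_0)
next
  case False
  define c where "c = - 2 * pi * of_int n"
  have "c \<noteq> 0" using False by (simp add: c_def)
  have e: "echar n = (\<lambda>a. cis (c * a))"
    by (simp add: echar_def c_def fun_eq_iff)
  have dens: "unit_uniform = density lborel (\<lambda>x. ennreal (indicator {0..<1} x))"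
    by (simp add: unit_uniform_def uniform_measure_def ennreal_indicator divide_ennreal_def)
  have "(LINT a|unit_uniform. echar n a) = (LINT a|lborel. indicator {0..<1} a *\<^sub>R echar n a)"
    unfolding dens by (rule integral_density) auto
  \<comment> \<open>Adding the null set \<open>{1}\<close> closes the interval, as the fundamental
    theorem of calculus requires.\<close>
  also have "\<dots> = (LINT a|lborel. indicator {0..1} a *\<^sub>R echar n a)"
  proof (rule integral_cong_AE)
    show "AE a in lborel. indicator {0..<1} a *\<^sub>R echar n a = indicator {0..1} a *\<^sub>R echar n a"
      using AE_lborel_singleton[of 1] by eventually_elim (auto simp: indicator_def)
  qed measurable
  also have "\<dots> = cis (c * 1) / (\<i> * c) - cis (c * 0) / (\<i> * c)"
  proof (rule integral_FTC_Icc)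
    fix x :: real
    have "((\<lambda>a. exp (\<i> * complex_of_real (c * a)) / (\<i> * c)) has_vector_derivative
        exp (\<i> * complex_of_real (c * x))) (at x within {0..1})"
    proof (rule has_vector_derivative_eq_rhs)
      show "((\<lambda>a. exp (\<i> * complex_of_real (c * a)) / (\<i> * c)) has_vector_derivative
          (exp (\<i> * complex_of_real (c * x)) * (\<i> * c) / (\<i> * c))) (at x within {0..1})"
        unfolding of_real_mult
        by (rule has_vector_derivative_real_field) (auto intro!: derivative_eq_intros simp: mult_ac)
    qed (rule nonzero_mult_div_cancel_right, use \<open>c \<noteq> 0\<close> in simp)
    then show "((\<lambda>a. cis (c * a) / (\<i> * c)) has_vector_derivative echar n x) (at x within {0..1})"
      by (simp add: e cis_conv_exp)
  qed (auto simp: continuous_on_echar)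
  also have "cis (c * 1) = 1"
    using cis_multiple_2pi[of "- of_int n"] by (simp add: c_def mult_ac)
  finally show ?thesis using False by simp
qed

lemma orthonormal_basis_echar: "orthonormal_basis_L2 unit_uniform UNIV echar"
  unfolding orthonormal_basis_L2_def
proof (intro conjI ballI allI impI)
  show "square_integrable unit_uniform (echar i)" for i
    using trig_poly_square_integrable[OF trig_poly_echar[of 1 i]] by simp
  show "L2_inner unit_uniform (echar i) (echar j) = (if i = j then 1 else 0)" for i j
    by (simp add: L2_inner_def cnj_echar echar_mult integral_echar)
  fix f and \<epsilon> :: real
  assume "square_integrable unit_uniform f" "\<epsilon> > 0"
  then obtain p where p: "trig_poly p" "(LINT a|unit_uniform. (cmod (f a - p a))\<^sup>2) < \<epsilon>\<^sup>2"
    using trig_approximableE[OF square_integrable_trig_approximable, of f "\<epsilon>\<^sup>2"] by auto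
  obtain F c where F: "finite F" "p = (\<lambda>a. \<Sum>n\<in>F. c n * echar n a)"
    using trig_poly_sum[OF p(1)] .
  have "L2_norm unit_uniform (\<lambda>a. f a - (\<Sum>n\<in>F. c n * echar n a)) < \<epsilon>"
    using p(2) \<open>\<epsilon> > 0\<close> by (simp add: L2_norm_def F(2) real_less_lsqrt)
  with F(1) show "\<exists>F c. finite F \<and> F \<subseteq> UNIV \<and>
      L2_norm unit_uniform (\<lambda>a. f a - (\<Sum>n\<in>F. c n * echar n a)) < \<epsilon>"
    by blast
qed

text \<open>On the segment the inner product sees only the first coordinate, so the exponential at
  \<open>l\<close> restricts to \<open>echar (\<nu> l)\<close>. The embedding of the line therefore
  carries the orthonormal basis of characters over, and distinct integer first coordinates keep the
  frequencies at distance at least 1.\<close>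

lemma segment_measure_spectrum:
  assumes \<nu>: "bij_betw \<nu> \<Lambda> (UNIV :: int set)" and fst: "\<And>l. l \<in> \<Lambda> \<Longrightarrow> l $ 1 = of_int (\<nu> l)"
  shows "is_spectrum segment_measure \<Lambda>"
proof -
  let ?e = "\<lambda>l x. exp (- 2 * complex_of_real pi * \<i> * complex_of_real (l \<bullet> x))"
  let ?j = "\<lambda>a. vector [a, 0] :: real^2"
  have j [measurable]: "?j \<in> unit_uniform \<rightarrow>\<^sub>M borel" by measurable
  have e [measurable]: "?e l \<in> borel_measurable borel" for l
    by (intro borel_measurable_continuous_onI continuous_intros)
  have cnj_e [measurable]: "(\<lambda>x. cnj (?e l x)) \<in> borel_measurable borel" for l
    by (intro borel_measurable_continuous_onI continuous_intros)
  have e_eq: "?e l (?j a) = echar (\<nu> l) a" if "l \<in> \<Lambda>" for l a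
    using fst[OF that] by (simp add: inner_vec_def sum_2 echar_def cis_conv_exp mult_ac)
  have int: "(LINT x|segment_measure. f x) = (LINT a|unit_uniform. f (?j a))"
    if "f \<in> borel_measurable borel" for f :: "real^2 \<Rightarrow> 'b::{banach, second_countable_topology}"
    unfolding segment_measure_def using that by (intro integral_distr) auto
  have sq: "square_integrable unit_uniform (\<lambda>a. f (?j a))"
    if "square_integrable segment_measure f" for f
  proof -
    have [measurable]: "f \<in> borel_measurable borel"
      using that by (simp add: square_integrable_def)
    have "integrable unit_uniform (\<lambda>a. (cmod (f (?j a)))\<^sup>2)"
      using that integrable_distr[OF j, of "\<lambda>x. (cmod (f x))\<^sup>2"]
      by (simp add: square_integrable_def segment_measure_def)
    then show ?thesis by (simp add: square_integrable_def)
  qed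
  have "uniform_discrete \<Lambda>"
  proof (rule uniformI2[of 1])
    fix x y assume xy: "x \<in> \<Lambda>" "y \<in> \<Lambda>" "x \<noteq> y"
    then have "\<nu> x \<noteq> \<nu> y" using \<nu> by (auto simp: bij_betw_def inj_on_def)
    then have "1 \<le> \<bar>\<nu> x - \<nu> y\<bar>" by simp
    then have "1 \<le> real_of_int \<bar>\<nu> x - \<nu> y\<bar>" by linarith
    also have "\<dots> = \<bar>(x - y) $ 1\<bar>" using xy by (simp add: fst)
    also have "\<dots> \<le> dist x y" unfolding dist_norm by (rule component_le_norm_cart)
    finally show "1 \<le> dist x y" .
  qed simp
  moreover have "orthonormal_basis_L2 segment_measure \<Lambda> ?e"
    unfolding orthonormal_basis_L2_def
  proof (intro conjI ballI allI impI)
    show "square_integrable segment_measure (?e l)" for l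
      by (rule square_integrable_bounded[where C = 1])
        (simp_all add: prob_space.finite_measure[OF prob_space_segment_measure])
    fix l m assume lm: "l \<in> \<Lambda>" "m \<in> \<Lambda>"
    have "L2_inner segment_measure (?e l) (?e m) = L2_inner unit_uniform (echar (\<nu> l)) (echar (\<nu> m))"
      unfolding L2_inner_def e_eq[OF lm(1), symmetric] e_eq[OF lm(2), symmetric]
      by (rule int) measurable
    also have "\<dots> = (if l = m then 1 else 0)"
      using orthonormal_basis_echar lm \<nu>
      by (auto simp: orthonormal_basis_L2_def bij_betw_def inj_on_def)
    finally show "L2_inner segment_measure (?e l) (?e m) = (if l = m then 1 else 0)" .
  next
    fix f and \<epsilon> :: real
    assume f: "square_integrable segment_measure f" and "\<epsilon> > 0"
    with sq[OF f] orthonormal_basis_echar obtain F c where F: "finite F"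
        "L2_norm unit_uniform (\<lambda>a. f (?j a) - (\<Sum>n\<in>F. c n * echar n a)) < \<epsilon>"
      unfolding orthonormal_basis_L2_def by blast
    \<comment> \<open>Each integer frequency in \<open>F\<close> is realised by exactly one point of
      \<open>\<Lambda>\<close>, so an approximation on the line reindexes to one in the
      plane.\<close>
    define G where "G = the_inv_into \<Lambda> \<nu> ` F"
    have bij: "bij_betw (the_inv_into \<Lambda> \<nu>) UNIV \<Lambda>"
      using \<nu> by (rule bij_betw_the_inv_into)
    have G: "finite G" "G \<subseteq> \<Lambda>"
      using F(1) bij by (auto simp: G_def bij_betw_def)
    have \<nu>_inv: "\<nu> (the_inv_into \<Lambda> \<nu> n) = n" for n
      using \<nu> by (intro f_the_inv_into_f) (auto simp: bij_betw_def)
    have [measurable]: "f \<in> borel_measurable borel"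
      using f by (simp add: square_integrable_def)
    have "(\<Sum>n\<in>F. c n * echar n a) = (\<Sum>l\<in>G. c (\<nu> l) * ?e l (?j a))" for a
    proof -
      have "(\<Sum>l\<in>G. c (\<nu> l) * ?e l (?j a)) = (\<Sum>l\<in>G. c (\<nu> l) * echar (\<nu> l) a)"
        using G e_eq by (intro sum.cong refl) (metis subsetD)
      also have "\<dots> = (\<Sum>n\<in>F. c n * echar n a)"
        unfolding G_def using bij
        by (subst sum.reindex) (auto simp: \<nu>_inv bij_betw_def intro: inj_on_subset)
      finally show ?thesis by simp
    qed
    then have "L2_norm segment_measure (\<lambda>x. f x - (\<Sum>l\<in>G. c (\<nu> l) * ?e l x))
        = L2_norm unit_uniform (\<lambda>a. f (?j a) - (\<Sum>n\<in>F. c n * echar n a))"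
      unfolding L2_norm_def by (simp only:) (subst int, measurable)
    with F(2) G show "\<exists>F c. finite F \<and> F \<subseteq> \<Lambda> \<and>
        L2_norm segment_measure (\<lambda>x. f x - (\<Sum>l\<in>F. c l * ?e l x)) < \<epsilon>"
      by (intro exI[of _ G] exI[of _ "\<lambda>l. c (\<nu> l)"]) simp
  qed
  ultimately show ?thesis
    by (simp add: is_spectrum_def uniform_discrete_imp_discrete)
qed


section \<open>Beurling densities of lifted integers\<close>

definition ball_density :: "real \<Rightarrow> (real^2) set \<Rightarrow> real \<Rightarrow> ennreal" where
  "ball_density r \<Lambda> h = (SUP x. emeasure (count_space UNIV) (\<Lambda> \<inter> ball x h) / ennreal (h powr r))"

lemma upper_beurling_density_alt: "upper_beurling_density r \<Lambda> = Limsup at_top (ball_density r \<Lambda>)"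
  unfolding upper_beurling_density_def ball_density_def ..

text \<open>Once \<open>h \<ge> 1\<close>, the denominator \<open>h powr r\<close> increases with
  \<open>r\<close>.\<close>

lemma upper_beurling_density_antimono:
  assumes "r \<le> r'"
  shows "upper_beurling_density r' \<Lambda> \<le> upper_beurling_density r \<Lambda>"
  unfolding upper_beurling_density_alt
proof (rule Limsup_mono)
  show "\<forall>\<^sub>F h in at_top. ball_density r' \<Lambda> h \<le> ball_density r \<Lambda> h"
    using eventually_ge_at_top[of 1]
  proof eventually_elim
    case (elim h)
    then have "h powr r \<le> h powr r'"
      using assms by (intro powr_mono)
    with elim have "inverse (ennreal (h powr r')) \<le> inverse (ennreal (h powr r))"
      by (simp add: inverse_ennreal ennreal_leI le_imp_inverse_le)
    then show ?case
      unfolding ball_density_def divide_ennreal_def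
      by (intro SUP_mono' mult_left_mono) simp_all
  qed
qed

text \<open>The value at the exponent \<open>t\<close> itself is left open, which lets one criterion
  serve both zero and positive density there.\<close>

lemma beurling_dim_eqI:
  assumes "0 < t" and above: "\<And>r. t < r \<Longrightarrow> upper_beurling_density r \<Lambda> = 0"
    and below: "\<And>r. 0 < r \<Longrightarrow> r < t \<Longrightarrow> upper_beurling_density r \<Lambda> \<noteq> 0"
  shows "beurling_dim \<Lambda> = ennreal t"
  unfolding beurling_dim_def
proof (rule antisym)
  let ?S = "{ennreal r |r. r > 0 \<and> upper_beurling_density r \<Lambda> = 0}"
  show "Inf ?S \<le> ennreal t"
  proof (rule ennreal_le_epsilon)
    fix e :: real assume "0 < e"
    then have "ennreal (t + e) \<in> ?S"
      using \<open>0 < t\<close> above[of "t + e"] by (intro CollectI exI[of _ "t + e"] conjI refl) auto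
    then have "Inf ?S \<le> ennreal (t + e)" by (rule Inf_lower)
    then show "Inf ?S \<le> ennreal t + ennreal e"
      using \<open>0 < t\<close> \<open>0 < e\<close> by simp
  qed
  show "ennreal t \<le> Inf ?S"
  proof (rule Inf_greatest)
    fix x assume "x \<in> ?S"
    then obtain r where r: "x = ennreal r" "r > 0" "upper_beurling_density r \<Lambda> = 0" by blast
    then have "t \<le> r" using below[of r] by (meson not_le)
    then show "ennreal t \<le> x" by (simp add: r(1) ennreal_leI)
  qed
qed

text \<open>Split off one factor, \<open>z powr p = z * z powr (p - 1)\<close>, and enlarge both
  bases to \<open>x + y\<close> in the remaining power.\<close>

lemma powr_superadditive:
  fixes x y p :: real
  assumes "0 \<le> x" "0 \<le> y" "1 \<le> p"
  shows "x powr p + y powr p \<le> (x + y) powr p"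
proof -
  have split: "z powr p = z * z powr (p - 1)" if "0 \<le> z" for z :: real
    using that powr_add[of z 1 "p - 1"] by (cases "z = 0") auto
  have "x powr p + y powr p = x * x powr (p - 1) + y * y powr (p - 1)"
    using assms by (simp add: split)
  also have "\<dots> \<le> x * (x + y) powr (p - 1) + y * (x + y) powr (p - 1)"
    using assms by (intro add_mono mult_left_mono powr_mono2) auto
  also have "\<dots> = (x + y) powr p"
    using assms by (simp add: split distrib_right)
  finally show ?thesis .
qed

section \<open>Lifted integers and upper bounds for ball counts\<close>

definition lift_height :: "real \<Rightarrow> (nat \<Rightarrow> real) \<Rightarrow> nat \<Rightarrow> real" where
  "lift_height t w k = (real k * w k) powr (1 / t)"

definition lift_point :: "real \<Rightarrow> (nat \<Rightarrow> real) \<Rightarrow> nat \<Rightarrow> real^2" where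
  "lift_point t w k = vector [of_int (int_decode k), lift_height t w k]"

lemma lift_point_nth [simp]:
  "lift_point t w k $ 1 = of_int (int_decode k)" "lift_point t w k $ 2 = lift_height t w k"
  by (simp_all add: lift_point_def)

lemma inj_lift_point: "inj (lift_point t w)"
proof (rule injI)
  fix j k assume "lift_point t w j = lift_point t w k"
  then have "lift_point t w j $ 1 = lift_point t w k $ 1" by simp
  then have "int_decode j = int_decode k" by simp
  then show "j = k" by (simp add: int_decode_eq)
qed

lemma abs_int_decode_le: "\<bar>int_decode k\<bar> \<le> int k"
  by (auto simp: int_decode_def sum_decode_def elim!: oddE)

lemma dist_lift_point_le:
  "dist (vector [0, y]) (lift_point t w k) \<le> real k + \<bar>lift_height t w k - y\<bar>"
proof -
  have "dist (vector [0, y]) (lift_point t w k) \<le> (\<Sum>i\<in>UNIV. \<bar>(vector [0, y] - lift_point t w k) $ i\<bar>)"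
    unfolding dist_norm by (rule norm_le_l1_cart)
  also have "\<dots> = real_of_int \<bar>int_decode k\<bar> + \<bar>lift_height t w k - y\<bar>"
    by (simp add: sum_2)
  also have "\<dots> \<le> real k + \<bar>lift_height t w k - y\<bar>"
    using of_int_le_iff[where 'a = real, of "\<bar>int_decode k\<bar>" "int k"] abs_int_decode_le[of k] by simp
  finally show ?thesis .
qed

lemma range_lift_point_spectrum: "is_spectrum segment_measure (range (lift_point t w))"
proof (rule segment_measure_spectrum)
  have "bij_betw (inv (lift_point t w)) (range (lift_point t w)) UNIV"
    using inj_lift_point by (intro bij_betw_inv_into) (simp add: bij_betw_def)
  then show "bij_betw (int_decode \<circ> inv (lift_point t w)) (range (lift_point t w)) UNIV"
    using bij_int_decode by (rule bij_betw_trans)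
  show "l $ 1 = of_int ((int_decode \<circ> inv (lift_point t w)) l)" if "l \<in> range (lift_point t w)" for l
    using that by (auto simp: inv_f_f inj_lift_point)
qed

text \<open>The exponent \<open>1 / t\<close> is at least 1, so the power is superadditive, and
  monotonicity raises both weights to \<open>w (i + j)\<close>. Consequently points whose indices
  differ by \<open>j\<close> differ in height by at least the height of index \<open>j\<close>,
  wherever they sit.\<close>

lemma lift_height_superadditive:
  assumes "0 < t" "t \<le> 1" "mono w" "\<And>k. 0 \<le> w k"
  shows "lift_height t w i + lift_height t w j \<le> lift_height t w (i + j)"
proof -
  have "lift_height t w i + lift_height t w j \<le> (real i * w i + real j * w j) powr (1 / t)"
    unfolding lift_height_def using assms by (intro powr_superadditive) auto
  also have "\<dots> \<le> lift_height t w (i + j)"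
    unfolding lift_height_def
  proof (rule powr_mono2)
    have "real i * w i + real j * w j \<le> real i * w (i + j) + real j * w (i + j)"
      by (intro add_mono mult_left_mono monoD[OF assms(3)]) auto
    then show "real i * w i + real j * w j \<le> real (i + j) * w (i + j)"
      by (simp add: distrib_right)
  qed (use assms in auto)
  finally show ?thesis .
qed

lemma lift_height_nonneg: "0 \<le> lift_height t w k"
  by (simp add: lift_height_def)

lemma lift_height_mono:
  assumes "0 < t" "mono w" "\<And>k. 0 \<le> w k" "j \<le> k"
  shows "lift_height t w j \<le> lift_height t w k"
  unfolding lift_height_def using assms
  by (intro powr_mono2 mult_mono) (auto dest: monoD)

text \<open>If \<open>m\<close> is the least index in the ball, any further index
  \<open>m + j\<close> there has \<open>lift_height t w j < 2 * h\<close> by superadditivity, whence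
  \<open>j * w j \<le> (2 * h) powr t\<close>. For \<open>j \<ge> J\<close> this bounds
  \<open>j\<close> through \<open>A\<close>; smaller offsets are absorbed by \<open>J\<close>, and
  the 1 accounts for offset 0. The bound is independent of the center.\<close>

lemma ball_count_le:
  assumes t: "0 < t" "t \<le> 1" and w: "mono w" "\<And>k. 0 \<le> w k"
    and A: "0 < A" "\<And>k. J \<le> k \<Longrightarrow> A \<le> w k" and "0 < h"
  shows "emeasure (count_space UNIV) (range (lift_point t w) \<inter> ball x h)
    \<le> ennreal (real J + 1 + (2 * h) powr t / A)"
proof (cases "range (lift_point t w) \<inter> ball x h = {}")
  case False
  define P where "P k \<longleftrightarrow> lift_point t w k \<in> ball x h" for k
  define m where "m = (LEAST k. P k)"
  define M where "M = real J + (2 * h) powr t / A"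
  have "\<exists>k. P k" using False by (auto simp: P_def)
  then have "P m" unfolding m_def by (rule LeastI_ex)
  have "M \<ge> 0" using A by (simp add: M_def)
  have le: "m \<le> k \<and> k \<le> m + nat \<lfloor>M\<rfloor>" if "P k" for k
  proof
    show "m \<le> k" unfolding m_def using that by (rule Least_le)
    then obtain j where j: "k = m + j" using le_Suc_ex by blast
    have "\<bar>lift_height t w k - lift_height t w m\<bar> = \<bar>(lift_point t w k - lift_point t w m) $ 2\<bar>" by simp
    also have "\<dots> \<le> dist (lift_point t w k) (lift_point t w m)"
      unfolding dist_norm by (rule component_le_norm_cart)
    also have "\<dots> < 2 * h"
      using that \<open>P m\<close> dist_triangle3[of "lift_point t w k" "lift_point t w m" x]
      by (simp add: P_def)
    finally have "lift_height t w j < 2 * h"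
      using lift_height_superadditive[OF t w, of m j] by (simp add: j)
    have "real j \<le> M"
    proof (cases "J \<le> j")
      case True
      then have "real j * A \<le> real j * w j" using A by (intro mult_left_mono) auto
      also have "\<dots> = lift_height t w j powr t"
        using t w by (simp add: lift_height_def powr_powr)
      also have "\<dots> \<le> (2 * h) powr t"
        using t \<open>lift_height t w j < 2 * h\<close> by (intro powr_mono2) (auto simp: lift_height_nonneg)
      finally have "real j \<le> (2 * h) powr t / A" using A by (simp add: field_simps)
      then show ?thesis by (simp add: M_def)
    next
      case False
      then show ?thesis using A by (simp add: M_def add_increasing2)
    qed
    then show "k \<le> m + nat \<lfloor>M\<rfloor>" by (simp add: j le_nat_floor)
  qed
  then have sub: "range (lift_point t w) \<inter> ball x h \<subseteq> lift_point t w ` {m..m + nat \<lfloor>M\<rfloor>}"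
    by (auto simp: P_def)
  then have fin: "finite (range (lift_point t w) \<inter> ball x h)"
    by (rule finite_subset) simp
  have "card (range (lift_point t w) \<inter> ball x h) \<le> card (lift_point t w ` {m..m + nat \<lfloor>M\<rfloor>})"
    by (intro card_mono sub) simp
  also have "\<dots> \<le> nat \<lfloor>M\<rfloor> + 1"
    using card_image_le[of "{m..m + nat \<lfloor>M\<rfloor>}" "lift_point t w"] by simp
  finally have "real (card (range (lift_point t w) \<inter> ball x h)) \<le> real (nat \<lfloor>M\<rfloor> + 1)"
    by (rule of_nat_mono)
  also have "\<dots> \<le> real J + 1 + (2 * h) powr t / A"
    using \<open>M \<ge> 0\<close> by (simp add: M_def) linarith
  finally show ?thesis
    using fin by (simp add: emeasure_count_space ennreal_of_nat_eq_real_of_nat ennreal_leI)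
qed simp

text \<open>The count is bounded uniformly in the center, so the bound passes to the supremum, and
  convergence replaces the upper limit by \<open>L\<close>.\<close>

lemma upper_density_le_lim:
  assumes t: "0 < t" "t \<le> 1" and w: "mono w" "\<And>k. 0 \<le> w k"
    and A: "0 < A" "\<And>k. J \<le> k \<Longrightarrow> A \<le> w k"
    and lim: "((\<lambda>h. (real J + 1 + (2 * h) powr t / A) / h powr r) \<longlongrightarrow> L) at_top"
  shows "upper_beurling_density r (range (lift_point t w)) \<le> ennreal L"
proof -
  have "upper_beurling_density r (range (lift_point t w))
      \<le> Limsup at_top (\<lambda>h. ennreal ((real J + 1 + (2 * h) powr t / A) / h powr r))"
    unfolding upper_beurling_density_alt
  proof (rule Limsup_mono)
    show "\<forall>\<^sub>F h in at_top. ball_density r (range (lift_point t w)) h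
        \<le> ennreal ((real J + 1 + (2 * h) powr t / A) / h powr r)"
      using eventually_gt_at_top[of 0]
    proof eventually_elim
      case (elim h)
      then have "emeasure (count_space UNIV) (range (lift_point t w) \<inter> ball x h) / ennreal (h powr r)
          \<le> ennreal (real J + 1 + (2 * h) powr t / A) / ennreal (h powr r)" for x
        by (intro divide_right_mono_ennreal ball_count_le[OF t w A]) auto
      moreover have "ennreal (real J + 1 + (2 * h) powr t / A) / ennreal (h powr r)
          = ennreal ((real J + 1 + (2 * h) powr t / A) / h powr r)"
        using elim A by (intro divide_ennreal) auto
      ultimately show ?case
        unfolding ball_density_def by (intro SUP_least) (simp only:)
    qed
  qed
  also have "\<dots> = ennreal L"
    by (intro lim_imp_Limsup tendsto_ennrealI lim) simp
  finally show ?thesis .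
qed

text \<open>At the exponent \<open>t\<close> the additive \<open>J + 1\<close> disappears in the
  limit. Hence \<open>A\<close> may be any lower bound that the weight satisfies eventually, without
  loss from a large \<open>J\<close>.\<close>

lemma upper_density_le:
  assumes "0 < t" "t \<le> 1" "mono w" "\<And>k. 0 \<le> w k" "0 < A" "\<And>k. J \<le> k \<Longrightarrow> A \<le> w k"
  shows "upper_beurling_density t (range (lift_point t w)) \<le> ennreal (2 powr t / A)"
proof (rule upper_density_le_lim[OF assms])
  have "((\<lambda>h. (real J + 1) / h powr t + 2 powr t / A) \<longlongrightarrow> 0 + 2 powr t / A) at_top"
    using \<open>0 < t\<close> by (intro tendsto_add tendsto_const) real_asymp
  moreover have "\<forall>\<^sub>F h in at_top. (real J + 1 + (2 * h) powr t / A) / h powr t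
      = (real J + 1) / h powr t + 2 powr t / A"
    using eventually_gt_at_top[of 0]
    by eventually_elim (simp add: powr_mult add_divide_distrib)
  ultimately show "((\<lambda>h. (real J + 1 + (2 * h) powr t / A) / h powr t) \<longlongrightarrow> 2 powr t / A) at_top"
    by (simp add: tendsto_cong)
qed

lemma upper_density_above_eq_0:
  assumes "0 < t" "t \<le> 1" "mono w" "\<And>k. 0 \<le> w k" "0 < A" "\<And>k. J \<le> k \<Longrightarrow> A \<le> w k" "t < r"
  shows "upper_beurling_density r (range (lift_point t w)) = 0"
proof -
  have "upper_beurling_density r (range (lift_point t w)) \<le> ennreal 0"
  proof (rule upper_density_le_lim[OF assms(1-6)])
    have "((\<lambda>h. (real J + 1) / h powr r + 2 powr t / A * h powr (t - r)) \<longlongrightarrow> 0 + 2 powr t / A * 0) at_top"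
      using assms by (intro tendsto_intros) real_asymp+
    moreover have "\<forall>\<^sub>F h in at_top. (real J + 1 + (2 * h) powr t / A) / h powr r
        = (real J + 1) / h powr r + 2 powr t / A * h powr (t - r)"
      using eventually_gt_at_top[of 0]
      by eventually_elim (simp add: powr_mult add_divide_distrib powr_diff)
    ultimately show "((\<lambda>h. (real J + 1 + (2 * h) powr t / A) / h powr r) \<longlongrightarrow> 0) at_top"
      by (simp add: tendsto_cong)
  qed
  then show ?thesis by simp
qed

section \<open>Lower bounds, and the exact density for constant weights\<close>

lemma ball_density_ge:
  assumes "lift_point t w ` {..N} \<subseteq> ball x h" "0 < h" "X \<le> real N + 1"
  shows "ennreal (X / h powr r) \<le> ball_density r (range (lift_point t w)) h"
proof -
  \<comment> \<open>The index 0 makes \<open>N + 1\<close> points, so \<open>X\<close> can be a real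
    number with \<open>N\<close> its integer part.\<close>
  have "ennreal X \<le> of_nat (card {..N})"
    using assms(3) by (simp add: ennreal_of_nat_eq_real_of_nat ennreal_leI add.commute del: of_nat_Suc)
  also have "card {..N} = card (lift_point t w ` {..N})"
    by (intro card_image[symmetric] inj_on_subset[OF inj_lift_point]) simp
  also have "of_nat \<dots> = emeasure (count_space UNIV) (lift_point t w ` {..N})"
    by (simp add: emeasure_count_space)
  also have "\<dots> \<le> emeasure (count_space UNIV) (range (lift_point t w) \<inter> ball x h)"
    using assms(1) by (intro emeasure_mono) auto
  finally have "ennreal X / ennreal (h powr r) \<le>
      emeasure (count_space UNIV) (range (lift_point t w) \<inter> ball x h) / ennreal (h powr r)"
    by (rule divide_right_mono_ennreal)
  also have "\<dots> \<le> ball_density r (range (lift_point t w)) h"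
    unfolding ball_density_def by (rule SUP_upper) simp
  finally show ?thesis
    using \<open>0 < h\<close> by (cases "X \<ge> 0") (simp_all add: divide_ennreal ennreal_neg divide_nonpos_nonneg)
qed

text \<open>
  The ball of radius \<open>h\<close> around \<open>(0, (1 - \<delta>) h)\<close> contains every point of height at most
  \<open>2 (1 - \<delta>) h\<close>, since the first coordinates of these points are of order \<open>h\<^sup>t = o(h)\<close>.
\<close>

lemma upper_density_const_ge:
  assumes t: "0 < t" "t < 1" and "0 < c" and \<delta>: "0 < \<delta>" "\<delta> < 1"
  shows "ennreal ((2 * (1 - \<delta>)) powr t / c) \<le> upper_beurling_density t (range (lift_point t (\<lambda>_. c)))"
  unfolding upper_beurling_density_alt
proof (rule le_Limsup)
  \<comment> \<open>The real index at which the height reaches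
    \<open>2 * (1 - \<delta>) * h\<close>.\<close>
  define X where "X h = (2 * (1 - \<delta>) * h) powr t / c" for h
  \<comment> \<open>This is \<open>X h / h\<close>; it tends to 0 because \<open>t < 1\<close>, so
    the indices involved, and with them the first coordinates, stay below
    \<open>\<delta> * h\<close>.\<close>
  have "((\<lambda>h. (2 * (1 - \<delta>)) powr t / c * h powr (t - 1)) \<longlongrightarrow> (2 * (1 - \<delta>)) powr t / c * 0) at_top"
    using t by (intro tendsto_mult tendsto_const) real_asymp
  then have "\<forall>\<^sub>F h in at_top. (2 * (1 - \<delta>)) powr t / c * h powr (t - 1) < \<delta>"
    using \<delta> by (intro order_tendstoD) auto
  then show "\<forall>\<^sub>F h in at_top. ennreal ((2 * (1 - \<delta>)) powr t / c)
      \<le> ball_density t (range (lift_point t (\<lambda>_. c))) h"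
    using eventually_gt_at_top[of 0]
  proof eventually_elim
    case (elim h)
    have "X h = (2 * (1 - \<delta>)) powr t / c * h powr (t - 1) * h"
      using elim \<delta> by (simp add: X_def powr_mult powr_diff)
    with elim have "X h < \<delta> * h"
      by (simp only: mult_strict_right_mono)
    moreover have "0 \<le> X h" using \<open>0 < c\<close> by (simp add: X_def)
    ultimately have X: "X h < \<delta> * h" "0 \<le> X h" by simp_all
    have "lift_point t (\<lambda>_. c) ` {..nat \<lfloor>X h\<rfloor>} \<subseteq> ball (vector [0, (1 - \<delta>) * h]) h"
    proof safe
      fix k assume "k \<le> nat \<lfloor>X h\<rfloor>"
      then have k: "real k \<le> X h" using X by linarith
      then have "real k * c \<le> (2 * (1 - \<delta>) * h) powr t"
        using \<open>0 < c\<close> by (simp add: X_def field_simps)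
      then have "lift_height t (\<lambda>_. c) k \<le> ((2 * (1 - \<delta>) * h) powr t) powr (1 / t)"
        unfolding lift_height_def using t \<open>0 < c\<close> by (intro powr_mono2) auto
      also have "\<dots> = 2 * (1 - \<delta>) * h"
        using t elim \<delta> by (simp add: powr_powr)
      finally have "\<bar>lift_height t (\<lambda>_. c) k - (1 - \<delta>) * h\<bar> \<le> (1 - \<delta>) * h"
        using lift_height_nonneg[of t "\<lambda>_. c" k] by (simp add: abs_le_iff algebra_simps)
      then have "dist (vector [0, (1 - \<delta>) * h]) (lift_point t (\<lambda>_. c) k) \<le> X h + (1 - \<delta>) * h"
        using dist_lift_point_le[of "(1 - \<delta>) * h" t "\<lambda>_. c" k] k by linarith
      also have "\<dots> < h" using X by (simp add: algebra_simps)
      finally show "lift_point t (\<lambda>_. c) k \<in> ball (vector [0, (1 - \<delta>) * h]) h" by simp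
    qed
    then have "ennreal (X h / h powr t) \<le> ball_density t (range (lift_point t (\<lambda>_. c))) h"
      by (rule ball_density_ge) (use elim X in linarith)+
    also have "X h / h powr t = (2 * (1 - \<delta>)) powr t / c"
      using elim \<delta> by (simp add: X_def powr_mult)
    finally show ?case .
  qed
qed simp

lemma upper_density_const:
  assumes t: "0 < t" "t < 1" and "0 < c"
  shows "upper_beurling_density t (range (lift_point t (\<lambda>_. c))) = ennreal (2 powr t / c)"
proof (rule antisym)
  show "upper_beurling_density t (range (lift_point t (\<lambda>_. c))) \<le> ennreal (2 powr t / c)"
    using assms by (intro upper_density_le[where J = 0]) (auto intro: monoI)
  \<comment> \<open>The lower bound is used with \<open>\<delta> = 1 / (n + 2)\<close>, where the
    shift by 2 keeps \<open>\<delta>\<close> strictly below 1 from \<open>n = 0\<close> on.\<close>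
  have "(\<lambda>n. (2 * (1 - 1 / real (n + 2))) powr t / c) \<longlonglongrightarrow> (2 * (1 - 0)) powr t / c"
    by (intro tendsto_intros) (real_asymp | use assms in simp)+
  then have "(\<lambda>n. ennreal ((2 * (1 - 1 / real (n + 2))) powr t / c)) \<longlonglongrightarrow> ennreal (2 powr t / c)"
    by (intro tendsto_ennrealI) simp
  then show "ennreal (2 powr t / c) \<le> upper_beurling_density t (range (lift_point t (\<lambda>_. c)))"
    by (rule LIMSEQ_le_const2) (intro exI allI impI upper_density_const_ge; use assms in simp)
qed

section \<open>Logarithmic weights: density zero without loss of dimension\<close>

definition log_weight :: "nat \<Rightarrow> real" where
  "log_weight k = ln (real k + 3)"

text \<open>The shift by 3 in the logarithm suffices because \<open>exp 1 \<le> 3\<close>.\<close>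

lemma log_weight_ge_1: "1 \<le> log_weight k"
proof -
  have "exp 1 \<le> real k + 3" using exp_le by linarith
  then show ?thesis unfolding log_weight_def by (simp add: ln_ge_iff)
qed

lemma log_weight_mono: "mono log_weight"
  by (auto intro!: monoI simp: log_weight_def)

text \<open>The weight is unbounded, so \<open>upper_density_le\<close> applies with
  \<open>A = n + 1\<close> for every \<open>n\<close>, each time with a suitable
  \<open>J\<close>.\<close>

lemma upper_density_log_weight:
  assumes t: "0 < t" "t < 1"
  shows "upper_beurling_density t (range (lift_point t log_weight)) = 0"
proof -
  have nonneg: "0 \<le> log_weight k" for k using log_weight_ge_1[of k] by simp
  have "filterlim log_weight at_top sequentially"
    unfolding log_weight_def by real_asymp
  then have "\<exists>J. \<forall>k\<ge>J. real (Suc n) \<le> log_weight k" for n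
    by (simp add: filterlim_at_top eventually_sequentially)
  then have "upper_beurling_density t (range (lift_point t log_weight)) \<le> ennreal (2 powr t / real (Suc n))" for n
    using upper_density_le[OF t(1) _ log_weight_mono nonneg, of "real (Suc n)"] t
    by (metis less_imp_le of_nat_0_less_iff zero_less_Suc)
  moreover have "(\<lambda>n. ennreal (2 powr t / real (Suc n))) \<longlonglongrightarrow> ennreal 0"
    by (intro tendsto_ennrealI) real_asymp
  ultimately have "upper_beurling_density t (range (lift_point t log_weight)) \<le> ennreal 0"
    by (intro LIMSEQ_le_const) auto
  then show ?thesis by simp
qed

text \<open>Test balls around the origin, just large enough for the points of index up to
  \<open>n\<close>, have radius comparable to \<open>(n * ln (n + 3)) powr (1 / t)\<close>. The
  density ratio is then of order \<open>n / (n * ln (n + 3)) powr (r / t)\<close>, which is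
  unbounded since \<open>r / t < 1\<close>.\<close>

lemma upper_density_log_weight_below:
  assumes t: "0 < t" "t < 1" and r: "0 < r" "r < t"
  shows "upper_beurling_density r (range (lift_point t log_weight)) \<noteq> 0"
proof
  have nonneg: "0 \<le> log_weight k" for k using log_weight_ge_1[of k] by simp
  \<comment> \<open>For \<open>n \<ge> 1\<close> the index is at most the height, so points of index
    up to \<open>n\<close> lie within twice the height of \<open>n\<close>; the factor 3 makes the
    inclusion in the open ball strict.\<close>
  define H where "H n = 3 * lift_height t log_weight n" for n
  have ge: "real n \<le> lift_height t log_weight n" if "1 \<le> n" for n
  proof -
    have "real n * 1 \<le> real n * log_weight n"
      using log_weight_ge_1 by (intro mult_left_mono) auto
    moreover have "real n powr 1 \<le> real n powr (1 / t)"
      using t that by (intro powr_mono) auto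
    moreover have "real n powr (1 / t) \<le> lift_height t log_weight n"
      unfolding lift_height_def using t calculation by (intro powr_mono2) auto
    ultimately show ?thesis by simp
  qed
  have "filterlim H at_top sequentially"
  proof (rule filterlim_at_top_mono[OF filterlim_real_sequentially])
    show "\<forall>\<^sub>F n in sequentially. real n \<le> H n"
      using eventually_ge_at_top[of 1] by eventually_elim (use ge in \<open>force simp: H_def\<close>)
  qed
  moreover assume "upper_beurling_density r (range (lift_point t log_weight)) = 0"
  then have "\<forall>\<^sub>F h in at_top. ball_density r (range (lift_point t log_weight)) h < 1"
    unfolding upper_beurling_density_alt by (intro Limsup_lessD) simp
  ultimately have small: "\<forall>\<^sub>F n in sequentially. ball_density r (range (lift_point t log_weight)) (H n) < 1"
    by (rule eventually_compose_filterlim[rotated])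
  define q where "q = r / t"
  have q: "0 < q" "q < 1" using t r by (auto simp: q_def)
  \<comment> \<open>The denominator is \<open>H n powr r\<close>, so eventually the ratio is at
    least 1, against the density being below 1 along \<open>H n\<close>.\<close>
  have "filterlim (\<lambda>n::nat. real n / (3 powr r * (real n * ln (real n + 3)) powr q)) at_top sequentially"
    using q by real_asymp
  then have "\<forall>\<^sub>F n in sequentially. 1 \<le> real n / (3 powr r * (real n * ln (real n + 3)) powr q)"
    by (simp add: filterlim_at_top)
  with small eventually_ge_at_top[of 1] have "\<forall>\<^sub>F n::nat in sequentially. False"
  proof eventually_elim
    case (elim n)
    have pos: "1 \<le> lift_height t log_weight n" using ge[of n] elim by simp
    have "lift_point t log_weight ` {..n} \<subseteq> ball (vector [0, 0]) (H n)"
    proof safe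
      fix k assume "k \<le> n"
      then have "lift_height t log_weight k \<le> lift_height t log_weight n"
        using t by (intro lift_height_mono log_weight_mono nonneg)
      then have "real k + \<bar>lift_height t log_weight k - 0\<bar> < H n"
        using ge[of n] elim \<open>k \<le> n\<close> pos lift_height_nonneg[of t log_weight k] by (simp add: H_def)
      with dist_lift_point_le[of 0 t log_weight k]
      show "lift_point t log_weight k \<in> ball (vector [0, 0]) (H n)" by simp
    qed
    then have "ennreal (real n / H n powr r) \<le> ball_density r (range (lift_point t log_weight)) (H n)"
      using pos by (intro ball_density_ge) (auto simp: H_def)
    also have "\<dots> < ennreal 1" using elim by simp
    finally have "real n / H n powr r < 1" by (simp add: ennreal_less_iff)
    moreover have "H n powr r = 3 powr r * (real n * ln (real n + 3)) powr q"
      using nonneg[of n] by (simp add: H_def lift_height_def powr_mult powr_powr q_def log_weight_def)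
    ultimately show False using elim by simp
  qed
  then show False by simp
qed

theorem theorem1p5:
  fixes R :: "real^2^2" and B :: "(real^2) set" and t s :: real
  defines "R \<equiv> vector [vector [2, 1], vector [0, 2]]"
    and "B \<equiv> {vector [0, 0], vector [1, 0]}"
  assumes "0 < t" "t < 1" "0 \<le> s"
  shows "\<exists>\<Lambda>. is_spectrum (self_affine_measure R B) \<Lambda> \<and>
    beurling_dim \<Lambda> = ennreal t \<and> upper_beurling_density t \<Lambda> = ennreal s"
proof -
  have \<mu>: "self_affine_measure R B = segment_measure"
    unfolding R_def B_def by (rule self_affine_measure_shear)
  show ?thesis
  proof (cases "s = 0")
    case True
    let ?\<Lambda> = "range (lift_point t log_weight)"
    have "upper_beurling_density r ?\<Lambda> = 0" if "t < r" for r
      using assms log_weight_mono log_weight_ge_1 that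
      by (intro upper_density_above_eq_0[where A = 1 and J = 0]) (auto intro: order_trans[OF zero_le_one])
    then have "beurling_dim ?\<Lambda> = ennreal t"
      using assms by (intro beurling_dim_eqI upper_density_log_weight_below)
    with True assms \<mu> show ?thesis
      by (intro exI[of _ ?\<Lambda>]) (simp add: range_lift_point_spectrum upper_density_log_weight)
  next
    case False
    \<comment> \<open>The solution of \<open>2 powr t / c = s\<close>, the density that a constant
      weight \<open>c\<close> produces.\<close>
    define c where "c = 2 powr t / s"
    have "c > 0" using False assms by (simp add: c_def)
    let ?\<Lambda> = "range (lift_point t (\<lambda>_. c))"
    have dens: "upper_beurling_density t ?\<Lambda> = ennreal s"
      using assms False \<open>c > 0\<close> by (simp add: upper_density_const c_def)
    have "upper_beurling_density r ?\<Lambda> = 0" if "t < r" for r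
      using assms \<open>c > 0\<close> that
      by (intro upper_density_above_eq_0[where A = c and J = 0]) (auto intro: monoI)
    \<comment> \<open>Below \<open>t\<close> the density is at least the positive value
      \<open>s\<close> attained at \<open>t\<close>, by monotonicity in the exponent.\<close>
    moreover have "upper_beurling_density r ?\<Lambda> \<noteq> 0" if "r < t" for r
      using upper_beurling_density_antimono[of r t ?\<Lambda>] that dens False assms by auto
    ultimately have "beurling_dim ?\<Lambda> = ennreal t"
      using assms by (intro beurling_dim_eqI) auto
    with dens \<mu> show ?thesis
      by (intro exI[of _ ?\<Lambda>]) (simp add: range_lift_point_spectrum)
  qed
qed

end
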